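(* Let $E:\mathbb{R}^d\to\mathbb{R}$ be twice continuously differentiable with (symmetric) Hessian $H(x)=\nabla^2E(x)$. Let $J\subset\mathbb{R}$ be an interval and let $\phi:J\to\mathbb{R}$ be a sign-preserving filter on $J$, i.e. a continuous odd function with $\phi(t)\,t>0$ for every $t\in J\setminus\{0\}$. For $\alpha>0$ and a shift $s$, define the filtered reflector $\mathcal{R}_{\phi,\alpha}(H;s)=\phi\bigl(\alpha(H-sI)\bigr)$ by the spectral functional calculus. Let $x_\star$ be a nondegenerate critical point of $E$ with Hessian $H_\star=H(x_\star)$ and Morse index $j$. Fix a target index $k\in\{1,\dots,d-1\}$, choose a shift $s_\star\in(\lambda_k(H_\star),\lambda_{k+1}(H_\star))$, and choose $\alpha>0$ so that every scaled shifted eigenvalue $\alpha(\lambda_i(H_\star)-s_\star)$, $i=1,\dots,d$, lies in $J$. Consider the filtered dynamics $$\dot x=-\mathcal{R}_{\phi,\alpha}(H(x);s_\star)\nabla E(x).$$ Then the linearization of this dynamics at $x_\star$ has exactly the same inertia (numbers of positive, negative and zero eigenvalues) as the exact shifted-sign linearization $\dot\xi=-\operatorname{sign}(H_\star-s_\star I)H_\star\,\xi$, which is the linearization at $x_\star$ of $\dot x=-\operatorname{sign}(H(x)-s_\star I)\nabla E(x)$. In particular, $x_\star$ is locally exponentially stable for the filtered dynamics if and only if $j=k$.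
   Context: For symmetric $A\in\mathbb{R}^{d\times d}$, $\lambda_1(A)\le\cdots\le\lambda_d(A)$ are its ordered eigenvalues, and $I$ is the identity matrix. For a scalar function $f$ defined on the spectrum of a symmetric matrix $A=Q\operatorname{diag}(\mu_i)Q^T$ ($Q$ orthogonal), the spectral functional calculus gives $f(A)=Q\operatorname{diag}(f(\mu_i))Q^T$; in particular $\operatorname{sign}(A)=Q\operatorname{diag}(\operatorname{sign}(\mu_i))Q^T$ when $A$ has no zero eigenvalue. A critical point $x_\star$ (that is, $\nabla E(x_\star)=0$) is nondegenerate if $\nabla^2E(x_\star)$ is invertible; its Morse index is the number of negative eigenvalues of $\nabla^2E(x_\star)$ counted with multiplicity. The linearization of $\dot x=F(x)$ at an equilibrium $x_\star$ is $\dot\xi=DF(x_\star)\xi$, and its inertia and eigenvalues are those of the matrix $DF(x_\star)$.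
   Formalization: The stability equivalence assumes that the filtered dynamics is defined in a neighbourhood of x⋆; this is proved when all scaled shifted eigenvalues lie in the interior of J, but can fail if one is an endpoint of J. The derivative at x⋆ is taken within the domain of the dynamics. *)

theory Defs
  imports "HOL-Analysis.Analysis" "HOL-Computational_Algebra.Polynomial"
begin

definition charpoly :: "real^'n^'n \<Rightarrow> real poly" where
  "charpoly A = det (\<chi> i j. (if i = j then [:0, 1:] else 0) - [:A $ i $ j:])"

text \<open>Only real eigenvalues are collected, each with its algebraic multiplicity. For a symmetric
  matrix this is the whole spectrum, so that there are \<open>CARD('n)\<close> of them.\<close>

definition eigenvalues :: "real^'n^'n \<Rightarrow> real multiset" where
  "eigenvalues A = proots (charpoly A)"

text \<open>The index is 1-based: \<open>eigval A 1\<close> is the smallest eigenvalue.\<close>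

definition eigval :: "real^'n^'n \<Rightarrow> nat \<Rightarrow> real" where
  "eigval A i = sorted_list_of_multiset (eigenvalues A) ! (i - 1)"

definition inertia :: "real^'n^'n \<Rightarrow> nat \<times> nat \<times> nat" where
  "inertia A = (size {# \<mu> \<in># eigenvalues A. \<mu> > 0 #},
                size {# \<mu> \<in># eigenvalues A. \<mu> < 0 #},
                size {# \<mu> \<in># eigenvalues A. \<mu> = 0 #})"

definition diag_mat :: "real^'n \<Rightarrow> real^'n^'n" where
  "diag_mat \<mu> = (\<chi> i j. if i = j then \<mu> $ i else 0)"

text \<open>For symmetric \<open>A\<close> an orthogonal diagonalization exists and the value does not
  depend on which one is taken. For other matrices the value is unspecified.\<close>

definition spectral_fun :: "(real \<Rightarrow> real) \<Rightarrow> real^'n^'n \<Rightarrow> real^'n^'n" where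
  "spectral_fun f A = (THE B. \<exists>Q \<mu>. orthogonal_matrix Q
      \<and> A = Q ** diag_mat \<mu> ** transpose Q
      \<and> B = Q ** diag_mat (\<chi> i. f (\<mu> $ i)) ** transpose Q)"

definition gradient :: "(real^'n \<Rightarrow> real) \<Rightarrow> real^'n \<Rightarrow> real^'n" where
  "gradient E x = (THE g. GDERIV E x :> g)"

definition hessian :: "(real^'n \<Rightarrow> real) \<Rightarrow> real^'n \<Rightarrow> real^'n^'n" where
  "hessian E x = matrix (frechet_derivative (gradient E) (at x))"

definition twice_continuously_differentiable :: "(real^'n \<Rightarrow> real) \<Rightarrow> bool" where
  "twice_continuously_differentiable E \<longleftrightarrow>
     (\<forall>x. E differentiable (at x)) \<and> (\<forall>x. gradient E differentiable (at x))
     \<and> continuous_on UNIV (hessian E)"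

definition nondegenerate_critical_point :: "(real^'n \<Rightarrow> real) \<Rightarrow> real^'n \<Rightarrow> bool" where
  "nondegenerate_critical_point E x \<longleftrightarrow> gradient E x = 0 \<and> invertible (hessian E x)"

definition morse_index :: "(real^'n \<Rightarrow> real) \<Rightarrow> real^'n \<Rightarrow> nat" where
  "morse_index E x = size {# \<mu> \<in># eigenvalues (hessian E x). \<mu> < 0 #}"

text \<open>A filter is a total function here, but only its values on \<open>J\<close> are constrained. For a
  \<open>J\<close> symmetric about \<open>0\<close> the second conjunct is ordinary oddness; symmetry of \<open>J\<close> is not
  required.\<close>

definition sign_preserving_filter :: "real set \<Rightarrow> (real \<Rightarrow> real) \<Rightarrow> bool" where
  "sign_preserving_filter J \<phi> \<longleftrightarrow> continuous_on J \<phi>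
     \<and> (\<forall>t\<in>J. - t \<in> J \<longrightarrow> \<phi> (- t) = - \<phi> t)
     \<and> (\<forall>t\<in>J - {0}. \<phi> t * t > 0)"

definition filtered_reflector ::
    "(real \<Rightarrow> real) \<Rightarrow> real \<Rightarrow> real \<Rightarrow> real^'n^'n \<Rightarrow> real^'n^'n" where
  "filtered_reflector \<phi> \<alpha> s H = spectral_fun \<phi> (\<alpha> *\<^sub>R (H - s *\<^sub>R mat 1))"

definition shifted_sign :: "real \<Rightarrow> real^'n^'n \<Rightarrow> real^'n^'n" where
  "shifted_sign s H = spectral_fun sgn (H - s *\<^sub>R mat 1)"

definition filtered_field ::
    "(real \<Rightarrow> real) \<Rightarrow> real \<Rightarrow> real \<Rightarrow> (real^'n \<Rightarrow> real) \<Rightarrow> real^'n \<Rightarrow> real^'n" where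
  "filtered_field \<phi> \<alpha> s E x = - (filtered_reflector \<phi> \<alpha> s (hessian E x) *v gradient E x)"

definition sign_field :: "real \<Rightarrow> (real^'n \<Rightarrow> real) \<Rightarrow> real^'n \<Rightarrow> real^'n" where
  "sign_field s E x = - (shifted_sign s (hessian E x) *v gradient E x)"

text \<open>Since \<open>\<phi>\<close> lives on \<open>J\<close> only, the filtered field is meaningful exactly at those points
  where all scaled shifted Hessian eigenvalues lie in \<open>J\<close>.\<close>

definition filtered_domain ::
    "real set \<Rightarrow> real \<Rightarrow> real \<Rightarrow> (real^'n \<Rightarrow> real) \<Rightarrow> (real^'n) set" where
  "filtered_domain J \<alpha> s E =
     {x. \<forall>i\<in>{1..CARD('n)}. \<alpha> * (eigval (hessian E x) i - s) \<in> J}"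

text \<open>\<open>A\<close> is the matrix \<open>DF(p)\<close> at the equilibrium \<open>p\<close> of the field \<open>F\<close> with domain \<open>D\<close>. If
  \<open>p\<close> is an interior point of \<open>D\<close>, this is the usual two-sided derivative, and \<open>A\<close> is unique.\<close>

definition is_linearization ::
    "(real^'n \<Rightarrow> real^'n) \<Rightarrow> (real^'n) set \<Rightarrow> real^'n \<Rightarrow> real^'n^'n \<Rightarrow> bool" where
  "is_linearization F D p A \<longleftrightarrow>
     p \<in> D \<and> F p = 0 \<and> (F has_derivative (\<lambda>\<xi>. A *v \<xi>)) (at p within D)"

definition is_solution ::
    "(real^'n \<Rightarrow> real^'n) \<Rightarrow> (real^'n) set \<Rightarrow> real set \<Rightarrow> (real \<Rightarrow> real^'n) \<Rightarrow> bool" where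
  "is_solution F D I x \<longleftrightarrow>
     (\<forall>t\<in>I. x t \<in> D \<and> (x has_vector_derivative F (x t)) (at t within I))"

text \<open>The fields considered here are continuous but in general not Lipschitz, so solutions need
  not be unique: a solution for all forward time is required to exist from every initial value
  near \<open>p\<close>, and the exponential bound is required of every solution, also of those given only
  on a bounded time interval.\<close>

definition locally_exponentially_stable ::
    "(real^'n \<Rightarrow> real^'n) \<Rightarrow> (real^'n) set \<Rightarrow> real^'n \<Rightarrow> bool" where
  "locally_exponentially_stable F D p \<longleftrightarrow>
     (\<exists>r>0. \<exists>C>0. \<exists>\<omega>>0. \<forall>x0\<in>ball p r.
        (\<exists>x. is_solution F D {0..} x \<and> x 0 = x0) \<and>
        (\<forall>T>0. \<forall>x. is_solution F D {0..T} x \<and> x 0 = x0 \<longrightarrow>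
           (\<forall>t\<in>{0..T}. norm (x t - p) \<le> C * exp (- \<omega> * t) * norm (x0 - p))))"

end

theory Submission
  imports Defs "HOL-Complex_Analysis.Great_Picard"
begin

text \<open>
  Write \<open>H(x)\<close> for the Hessian and \<open>R(x)\<close> for a reflector, so that both fields are
  \<open>-R(x) \<nabla>E(x)\<close>. Since \<open>\<nabla>E\<close> vanishes at the critical point \<open>p\<close>, the variation of \<open>R\<close>
  contributes only \<open>o(norm (x - p))\<close>: continuity of \<open>R\<close> at \<open>p\<close> already gives the linearization
  \<open>-R(p) H(p)\<close> (\<open>is_linearization_matrix_times_vanishing_field\<close>).

  Continuity of \<open>R\<close> is continuity of the spectral functional calculus \<open>A \<mapsto> f(A)\<close> on symmetric
  matrices with spectrum in a set on which \<open>f\<close> is continuous (\<open>continuous_on_spectral_fun\<close>). The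
  diagonalizing orthogonal matrices of a convergent sequence \<open>A n\<close> may jump, but they lie in a
  compact set, and every cluster point diagonalizes the limit; as \<open>f(A)\<close> is independent of the
  chosen diagonalization, all subsequential limits of \<open>f(A n)\<close> agree. The same compactness shows
  that the spectrum stays in an open set under small perturbations. The Hessian is symmetric by
  the classical second-difference argument (\<open>hessian_symmetric\<close>).

  All matrices at \<open>p\<close> are functions of the one matrix \<open>H(p) = Q diag(h) Q\<^sup>T\<close>. So the two
  linearizations are \<open>Q diag(l) Q\<^sup>T\<close> and \<open>Q diag(m) Q\<^sup>T\<close> with
  \<open>l i = - \<phi>(\<alpha> (h i - s)) h i\<close> and \<open>m i = - sgn(h i - s) h i\<close>, and sign preservation of \<open>\<phi>\<close>
  makes \<open>l i\<close> and \<open>m i\<close> agree in sign; this is the equality of inertias. Moreover \<open>l i < 0\<close> holds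
  exactly if \<open>h i\<close> lies on the same side of \<open>0\<close> as of \<open>s\<close>. There are \<open>j\<close> indices with \<open>h i < 0\<close>
  and \<open>k\<close> with \<open>h i < s\<close>; the two index sets are nested, hence equal if and only if \<open>j = k\<close>. Thus
  all eigenvalues of the symmetric linearization are negative exactly for \<open>j = k\<close>.

  It remains to pass from the linearization to the field, which is only continuous. If the
  linearization is negative definite, the squared distance to \<open>p\<close> is a strict Lyapunov function on
  a small ball, which bounds every solution; existence of solutions for all forward time comes from
  Peano's theorem, applied to the field composed with the projection to that ball
  (\<open>locally_exponentially_stable_if_negative_definite\<close>). If there is a positive eigenvalue, a
  solution starting at distance \<open>\<epsilon>\<close> along its eigenvector keeps its component in that direction
  at least \<open>\<epsilon>\<close> for as long as the linearization dominates the error, whereas exponential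
  stability would make it shorter than \<open>\<epsilon>\<close> after a time independent of \<open>\<epsilon>\<close>
  (\<open>not_locally_exponentially_stable_if_unstable_direction\<close>).
\<close>

section \<open>Orthogonal diagonalization of symmetric matrices\<close>

lemma symmetric_matrix_inner:
  fixes A :: "real^'n^'n"
  assumes "transpose A = A"
  shows "(A *v x) \<bullet> y = x \<bullet> (A *v y)"
  by (metis assms dot_lmul_matrix transpose_matrix_vector)

text \<open>A maximizer \<open>v\<close> of the Rayleigh quotient on the unit sphere of \<open>S\<close> is an eigenvector: the
  residual \<open>u = A v - l v\<close> lies in \<open>S\<close> and is orthogonal to \<open>v\<close>, and moving from \<open>v\<close> towards \<open>u\<close>
  increases the quotient to first order by \<open>2 (u \<bullet> u)\<close>.\<close>

lemma symmetric_matrix_eigenvector_in_subspace: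
  fixes A :: "real^'n^'n"
  assumes sym: "transpose A = A" and S: "subspace S" "S \<noteq> {0}"
    and inv: "\<And>x. x \<in> S \<Longrightarrow> A *v x \<in> S"
  obtains v l where "v \<in> S" "norm v = 1" "A *v v = l *\<^sub>R v"
proof -
  let ?K = "S \<inter> sphere 0 1"
  obtain z where z: "z \<in> S" "z \<noteq> 0"
    using S subspace_0 by blast
  then have "z /\<^sub>R norm z \<in> ?K"
    using S by (simp add: subspace_scale)
  moreover have "compact ?K"
    using closed_subspace[OF S(1)] by (simp add: closed_Int_compact)
  moreover have "continuous_on ?K (\<lambda>x. (A *v x) \<bullet> x)"
    by (intro continuous_intros matrix_vector_mult_linear_continuous_on)
  ultimately obtain v where v: "v \<in> ?K" and max: "\<And>x. x \<in> ?K \<Longrightarrow> (A *v x) \<bullet> x \<le> (A *v v) \<bullet> v"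
    using continuous_attains_sup[of ?K "\<lambda>x. (A *v x) \<bullet> x"] by blast
  define l where "l = (A *v v) \<bullet> v"
  have vS: "v \<in> S" and v1: "v \<bullet> v = 1" "norm v = 1"
    using v by (auto simp: dot_square_norm)
  have ray: "(A *v w) \<bullet> w \<le> l * (w \<bullet> w)" if "w \<in> S" for w
  proof (cases "w = 0")
    case False
    then have "w /\<^sub>R norm w \<in> ?K"
      using S that by (simp add: subspace_scale)
    then have "(A *v (w /\<^sub>R norm w)) \<bullet> (w /\<^sub>R norm w) \<le> l"
      unfolding l_def by (rule max)
    then have "((A *v w) \<bullet> w) / (norm w)\<^sup>2 \<le> l"
      by (simp add: matrix_vector_mult_scaleR power2_eq_square divide_inverse mult_ac)
    then show ?thesis
      using False by (simp add: divide_le_eq dot_square_norm)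
  qed simp
  define u where "u = A *v v - l *\<^sub>R v"
  have uS: "u \<in> S"
    using inv vS S by (simp add: u_def subspace_diff subspace_scale)
  have uv: "u \<bullet> v = 0"
    by (simp add: u_def l_def inner_diff_left v1)
  define a where "a = u \<bullet> u"
  have Avu: "(A *v v) \<bullet> u = a"
    using uv by (simp add: a_def u_def inner_diff_right inner_diff_left inner_commute)
  define c where "c = l * a - (A *v u) \<bullet> u"
  have quad: "2 * t * a \<le> t\<^sup>2 * c" for t
  proof -
    have "v + t *\<^sub>R u \<in> S"
      using vS uS S by (simp add: subspace_add subspace_scale)
    from ray[OF this] have "(A *v v + t *\<^sub>R (A *v u)) \<bullet> (v + t *\<^sub>R u) \<le> l * ((v + t *\<^sub>R u) \<bullet> (v + t *\<^sub>R u))"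
      by (simp add: matrix_vector_right_distrib matrix_vector_mult_scaleR)
    moreover have "(A *v u) \<bullet> v = a"
      using Avu symmetric_matrix_inner[OF sym, of u v] by (simp add: inner_commute)
    moreover have "(A *v v) \<bullet> v = l" by (simp add: l_def)
    ultimately show ?thesis
      using uv v1 Avu
      by (simp add: inner_add_left inner_add_right c_def a_def[symmetric] inner_commute
            algebra_simps power2_eq_square)
  qed
  have "a \<le> 0"
  proof (rule ccontr)
    assume "\<not> a \<le> 0"
    then have a: "a > 0" by simp
    \<comment> \<open>small enough for the first-order gain to beat the quadratic term\<close>
    define t where "t = a / (\<bar>c\<bar> + 1)"
    have t: "t > 0" using a by (simp add: t_def)
    from quad[of t] have "t * (2 * a) \<le> t * (t * c)" by (simp add: power2_eq_square algebra_simps)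
    then have "2 * a \<le> t * c" using t by simp
    also have "\<dots> \<le> t * (\<bar>c\<bar> + 1)" using t by (intro mult_left_mono) auto
    also have "\<dots> = a" by (simp add: t_def)
    finally show False using a by simp
  qed
  then have "u = 0" by (metis a_def inner_eq_zero_iff inner_ge_zero order_antisym)
  then show thesis using that vS v1 by (simp add: u_def)
qed

text \<open>Split off one eigenvector; its orthogonal complement in \<open>S\<close> is again invariant because \<open>A\<close> is
  symmetric.\<close>

lemma orthonormal_eigenbasis:
  fixes A :: "real^'n^'n"
  assumes sym: "transpose A = A" and S: "subspace S"
    and inv: "\<And>x. x \<in> S \<Longrightarrow> A *v x \<in> S"
  shows "\<exists>B. finite B \<and> B \<subseteq> S \<and> card B = dim S \<and> pairwise orthogonal B
           \<and> (\<forall>b\<in>B. norm b = 1 \<and> (\<exists>l. A *v b = l *\<^sub>R b))"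
  using S inv
proof (induction "dim S" arbitrary: S)
  case 0
  then show ?case by (intro exI[of _ "{}"]) auto
next
  case (Suc m)
  from Suc.hyps have "S \<noteq> {0}" by force
  then obtain v l where v: "v \<in> S" "norm v = 1" "A *v v = l *\<^sub>R v"
    using symmetric_matrix_eigenvector_in_subspace[OF sym Suc.prems(1) _ Suc.prems(2)] by blast
  define S' where "S' = {y \<in> S. \<forall>x\<in>span {v}. orthogonal x y}"
  have v0: "v \<noteq> 0" using v by auto
  have S'_iff: "y \<in> S' \<longleftrightarrow> y \<in> S \<and> v \<bullet> y = 0" for y
    by (auto simp: S'_def span_singleton orthogonal_def)
  have "dim S' + dim (span {v}) = dim S"
    unfolding S'_def using v Suc.prems
    by (intro dim_subspace_orthogonal_to_vectors) (auto simp: span_minimal)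
  then have m: "m = dim S'"
    using Suc.hyps(2) v0 by (simp add: dim_singleton)
  have sub: "subspace S'"
    using Suc.prems(1) by (auto simp: subspace_def S'_iff inner_add_right)
  have inv': "A *v y \<in> S'" if "y \<in> S'" for y
    using that Suc.prems(2) symmetric_matrix_inner[OF sym, of v y] v(3) by (simp add: S'_iff)
  obtain B where B: "finite B" "B \<subseteq> S'" "card B = dim S'" "pairwise orthogonal B"
      "\<forall>b\<in>B. norm b = 1 \<and> (\<exists>l. A *v b = l *\<^sub>R b)"
    using Suc.hyps(1)[OF m sub inv'] by blast
  have "v \<notin> B" using B(2) v0 by (auto simp: S'_iff)
  then have "card (insert v B) = dim S"
    using B m Suc.hyps(2) by simp
  moreover have "pairwise orthogonal (insert v B)"
    using B(2,4) by (force simp: pairwise_insert orthogonal_def S'_iff inner_commute)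
  ultimately show ?case
    using B v by (intro exI[of _ "insert v B"]) (auto simp: S'_iff)
qed

lemma matrix_mult_diag_mat: "(Q ** diag_mat \<mu>) $ a $ i = Q $ a $ i * \<mu> $ i"
proof -
  have "(Q ** diag_mat \<mu>) $ a $ i = (\<Sum>k\<in>UNIV. if k = i then Q $ a $ k * \<mu> $ k else 0)"
    unfolding matrix_matrix_mult_def diag_mat_def vec_lambda_beta by (rule sum.cong) auto
  then show ?thesis by simp
qed

lemma diag_mat_matrix_mult: "(diag_mat \<mu> ** Q) $ i $ a = \<mu> $ i * Q $ i $ a"
proof -
  have "(diag_mat \<mu> ** Q) $ i $ a = (\<Sum>k\<in>UNIV. if k = i then \<mu> $ i * Q $ k $ a else 0)"
    unfolding matrix_matrix_mult_def diag_mat_def vec_lambda_beta by (rule sum.cong) auto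
  then show ?thesis by simp
qed

lemma symmetric_matrix_diagonalization:
  fixes A :: "real^'n^'n"
  assumes sym: "transpose A = A"
  obtains Q \<mu> where "orthogonal_matrix Q" "A = Q ** diag_mat \<mu> ** transpose Q"
proof -
  obtain B where B: "finite B" "card B = dim (UNIV :: (real^'n) set)" "pairwise orthogonal B"
      and eig: "\<forall>b\<in>B. norm b = 1 \<and> (\<exists>l. A *v b = l *\<^sub>R b)"
    using orthonormal_eigenbasis[OF sym subspace_UNIV] by blast
  have "card B = CARD('n)" using B(2) by (simp add: dim_UNIV)
  then obtain f where f: "bij_betw f (UNIV :: 'n set) B"
    using B(1) by (metis bij_betw_iff_card finite)
  have fB: "f i \<in> B" for i using f by (simp add: bij_betw_apply)
  then have "\<forall>i. \<exists>l. A *v f i = l *\<^sub>R f i" using eig by blast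
  then obtain l where l: "A *v f i = l i *\<^sub>R f i" for i by metis
  define Q :: "real^'n^'n" where "Q = (\<chi> a i. f i $ a)"
  have col: "column i Q = f i" for i
    by (simp add: column_def Q_def vec_eq_iff)
  have "f i \<noteq> f j" if "i \<noteq> j" for i j
    using f that by (meson UNIV_I bij_betw_def inj_onD)
  then have Q: "orthogonal_matrix Q"
    unfolding orthogonal_matrix_orthonormal_columns col
    using B(3) eig fB by (simp add: pairwise_def)
  have "A ** Q = Q ** diag_mat (\<chi> i. l i)"
  proof -
    have "(A ** Q) $ a $ i = (A *v f i) $ a" for a i
      by (simp add: matrix_matrix_mult_def matrix_vector_mult_def Q_def)
    then show ?thesis
      by (simp add: vec_eq_iff matrix_mult_diag_mat l) (simp add: Q_def mult.commute)
  qed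
  then have "A ** (Q ** transpose Q) = Q ** diag_mat (\<chi> i. l i) ** transpose Q"
    by (simp only: matrix_mul_assoc)
  then have "A = Q ** diag_mat (\<chi> i. l i) ** transpose Q"
    using Q by (simp add: orthogonal_matrix_def)
  then show thesis using that Q by blast
qed

lemma conjugate_diag_mat_entry:
  "(Q ** diag_mat \<mu> ** transpose Q) $ a $ b = (\<Sum>i\<in>UNIV. \<mu> $ i * Q $ a $ i * Q $ b $ i)"
proof -
  have "(Q ** diag_mat \<mu> ** transpose Q) $ a $ b
      = (\<Sum>i\<in>UNIV. (Q ** diag_mat \<mu>) $ a $ i * transpose Q $ i $ b)"
    unfolding matrix_matrix_mult_def[of "Q ** diag_mat \<mu>"] vec_lambda_beta ..
  then show ?thesis
    unfolding matrix_mult_diag_mat transpose_def vec_lambda_beta by (simp add: mult_ac)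
qed

lemma symmetric_conjugate_diag_mat:
  "transpose (Q ** diag_mat \<mu> ** transpose Q) = Q ** diag_mat \<mu> ** transpose Q"
proof -
  have "transpose (Q ** diag_mat \<mu> ** transpose Q) $ a $ b = (Q ** diag_mat \<mu> ** transpose Q) $ a $ b" for a b
    unfolding transpose_def[of "Q ** diag_mat \<mu> ** transpose Q"] vec_lambda_beta conjugate_diag_mat_entry
    by (simp add: mult_ac)
  then show ?thesis by (intro iffD2[OF vec_eq_iff] allI)
qed

lemma conjugate_diag_mat_shift_scale:
  fixes Q :: "real^'n^'n"
  assumes "orthogonal_matrix Q"
  shows "a *\<^sub>R (Q ** diag_mat \<mu> ** transpose Q - s *\<^sub>R mat 1)
       = Q ** diag_mat (\<chi> i. a * (\<mu> $ i - s)) ** transpose Q"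
proof -
  have "(mat 1 :: real^'n^'n) $ x $ y = (\<Sum>i\<in>UNIV. Q $ x $ i * Q $ y $ i)" for x y
  proof -
    have "mat 1 $ x $ y = (Q ** transpose Q) $ x $ y"
      using assms by (simp add: orthogonal_matrix_def)
    then show ?thesis by (simp add: matrix_matrix_mult_def transpose_def)
  qed
  then have "(a *\<^sub>R (Q ** diag_mat \<mu> ** transpose Q - s *\<^sub>R mat 1)) $ x $ y
       = (Q ** diag_mat (\<chi> i. a * (\<mu> $ i - s)) ** transpose Q) $ x $ y" for x y
    by (simp only: vector_scaleR_component vector_minus_component conjugate_diag_mat_entry)
      (simp add: sum_distrib_left sum_subtractf algebra_simps)
  then show ?thesis by (intro iffD2[OF vec_eq_iff] allI)
qed

lemma conjugate_diag_mat_mult: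
  fixes Q :: "real^'n^'n"
  assumes "orthogonal_matrix Q"
  shows "(Q ** diag_mat \<mu> ** transpose Q) ** (Q ** diag_mat \<nu> ** transpose Q)
       = Q ** diag_mat (\<chi> i. \<mu> $ i * \<nu> $ i) ** transpose Q"
proof -
  have "(Q ** diag_mat \<mu> ** transpose Q) ** (Q ** diag_mat \<nu> ** transpose Q)
      = Q ** diag_mat \<mu> ** (transpose Q ** Q) ** diag_mat \<nu> ** transpose Q"
    by (simp only: matrix_mul_assoc)
  also have "\<dots> = Q ** (diag_mat \<mu> ** diag_mat \<nu>) ** transpose Q"
    using assms by (simp add: orthogonal_matrix_def matrix_mul_assoc)
  also have "diag_mat \<mu> ** diag_mat \<nu> = (diag_mat (\<chi> i. \<mu> $ i * \<nu> $ i) :: real^'n^'n)"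
    by (simp only: vec_eq_iff matrix_mult_diag_mat) (simp add: diag_mat_def)
  finally show ?thesis .
qed

lemma uminus_conjugate_diag_mat:
  "- (Q ** diag_mat \<mu> ** transpose Q) = Q ** diag_mat (- \<mu>) ** transpose Q"
proof -
  have "(- (Q ** diag_mat \<mu> ** transpose Q)) $ a $ b = (Q ** diag_mat (- \<mu>) ** transpose Q) $ a $ b" for a b
    by (simp only: vector_uminus_component conjugate_diag_mat_entry) (simp add: sum_negf)
  then show ?thesis by (intro iffD2[OF vec_eq_iff] allI)
qed

lemma conjugate_diag_mat_column:
  fixes Q :: "real^'n^'n"
  assumes Q: "orthogonal_matrix Q"
  shows "(Q ** diag_mat \<mu> ** transpose Q) *v column i Q = \<mu> $ i *\<^sub>R column i Q"
proof -
  have "Q ** diag_mat \<mu> = (Q ** diag_mat \<mu>) ** (transpose Q ** Q)"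
    using Q by (simp add: orthogonal_matrix_def)
  then have "(Q ** diag_mat \<mu> ** transpose Q) ** Q = Q ** diag_mat \<mu>"
    by (simp only: matrix_mul_assoc)
  then have "column i ((Q ** diag_mat \<mu> ** transpose Q) ** Q) = column i (Q ** diag_mat \<mu>)"
    by simp
  moreover have "column i (B ** Q) = B *v column i Q" for B :: "real^'n^'n"
    by (simp add: column_def matrix_matrix_mult_def matrix_vector_mult_def)
  moreover have "column i (Q ** diag_mat \<mu>) = \<mu> $ i *\<^sub>R column i Q"
    by (simp add: column_def matrix_mult_diag_mat vec_eq_iff mult.commute)
  ultimately show ?thesis by simp
qed

text \<open>In the coordinates \<open>Q\<^sup>T \<xi>\<close> the form is \<open>\<Sum>i. \<mu> i (Q\<^sup>T \<xi>) i ^ 2\<close>, and \<open>Q\<^sup>T\<close> is an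
  isometry.\<close>

lemma inner_conjugate_diag_mat_le:
  fixes Q :: "real^'n^'n"
  assumes Q: "orthogonal_matrix Q" and m: "\<And>i. \<mu> $ i \<le> m"
  shows "((Q ** diag_mat \<mu> ** transpose Q) *v \<xi>) \<bullet> \<xi> \<le> m * (\<xi> \<bullet> \<xi>)"
proof -
  define y where "y = transpose Q *v \<xi>"
  have dy: "(diag_mat \<mu> *v y) $ i = \<mu> $ i * y $ i" for i
  proof -
    have "(diag_mat \<mu> *v y) $ i = (\<Sum>k\<in>UNIV. if k = i then \<mu> $ k * y $ k else 0)"
      unfolding matrix_vector_mult_def diag_mat_def vec_lambda_beta by (rule sum.cong) auto
    then show ?thesis by simp
  qed
  have "((Q ** diag_mat \<mu> ** transpose Q) *v \<xi>) \<bullet> \<xi> = (Q *v (diag_mat \<mu> *v y)) \<bullet> \<xi>"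
    by (simp only: y_def matrix_vector_mul_assoc matrix_mul_assoc)
  also have "\<dots> = (diag_mat \<mu> *v y) \<bullet> y"
    unfolding y_def by (metis dot_lmul_matrix transpose_matrix_vector transpose_transpose)
  also have "\<dots> = (\<Sum>i\<in>UNIV. \<mu> $ i * (y $ i)\<^sup>2)"
    by (simp add: inner_vec_def dy power2_eq_square mult.assoc)
  also have "\<dots> \<le> (\<Sum>i\<in>UNIV. m * (y $ i)\<^sup>2)"
    by (intro sum_mono mult_right_mono m) simp
  also have "\<dots> = m * (y \<bullet> y)"
    by (simp add: inner_vec_def power2_eq_square sum_distrib_left)
  also have "y \<bullet> y = (Q *v y) \<bullet> \<xi>"
    unfolding y_def by (metis dot_lmul_matrix transpose_matrix_vector transpose_transpose)
  also have "Q *v y = \<xi>"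
    using Q by (simp add: y_def matrix_vector_mul_assoc orthogonal_matrix_def del: transpose_matrix_vector)
  finally show ?thesis .
qed

lemma invertible_conjugate_diag_mat_nonzero:
  fixes Q :: "real^'n^'n"
  assumes "invertible (Q ** diag_mat \<mu> ** transpose Q)"
  shows "\<mu> $ i \<noteq> 0"
proof -
  have "det (diag_mat \<mu> :: real^'n^'n) \<noteq> 0"
    using assms by (simp add: invertible_det_nz det_mul)
  then show ?thesis
    by (subst (asm) det_diagonal) (simp_all add: diag_mat_def)
qed

section \<open>Functional calculus and spectrum\<close>

text \<open>The matrix \<open>R = P\<^sup>T Q\<close> intertwines the two diagonal matrices, so its entry \<open>(i, j)\<close> vanishes
  unless \<open>\<nu> i = \<mu> j\<close>; hence it also intertwines their images under \<open>f\<close>. This independence of the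
  diagonalization is what makes the functional calculus well defined, also for repeated
  eigenvalues.\<close>

lemma conjugate_diag_mat_fun_unique:
  fixes P Q :: "real^'n^'n"
  assumes P: "orthogonal_matrix P" and Q: "orthogonal_matrix Q"
    and eq: "Q ** diag_mat \<mu> ** transpose Q = P ** diag_mat \<nu> ** transpose P"
  shows "Q ** diag_mat (\<chi> i. f (\<mu> $ i)) ** transpose Q
       = P ** diag_mat (\<chi> i. f (\<nu> $ i)) ** transpose P"
proof -
  define R where "R = transpose P ** Q"
  have QQ: "transpose Q ** Q = mat 1" "Q ** transpose Q = mat 1"
    and PP: "transpose P ** P = mat 1" "P ** transpose P = mat 1"
    using P Q by (auto simp: orthogonal_matrix_def)
  have "R ** diag_mat \<mu> = transpose P ** Q ** diag_mat \<mu> ** (transpose Q ** Q)"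
    by (simp add: QQ R_def)
  also have "\<dots> = transpose P ** (Q ** diag_mat \<mu> ** transpose Q) ** Q"
    by (simp only: matrix_mul_assoc)
  also have "\<dots> = (transpose P ** P) ** diag_mat \<nu> ** (transpose P ** Q)"
    by (simp only: eq) (simp only: matrix_mul_assoc)
  also have "\<dots> = diag_mat \<nu> ** R"
    by (simp add: PP R_def)
  finally have comm: "R $ i $ j * \<mu> $ j = \<nu> $ i * R $ i $ j" for i j
    by (metis diag_mat_matrix_mult matrix_mult_diag_mat)
  have "R $ i $ j * f (\<mu> $ j) = f (\<nu> $ i) * R $ i $ j" for i j
    using comm[of i j] by (cases "R $ i $ j = 0") auto
  then have "R ** diag_mat (\<chi> i. f (\<mu> $ i)) = diag_mat (\<chi> i. f (\<nu> $ i)) ** R"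
    by (simp add: vec_eq_iff diag_mat_matrix_mult matrix_mult_diag_mat)
  then have eqf: "P ** (R ** diag_mat (\<chi> i. f (\<mu> $ i))) ** transpose Q
           = P ** (diag_mat (\<chi> i. f (\<nu> $ i)) ** R) ** transpose Q" by simp
  have "Q ** diag_mat (\<chi> i. f (\<mu> $ i)) ** transpose Q
      = (P ** transpose P) ** Q ** diag_mat (\<chi> i. f (\<mu> $ i)) ** transpose Q"
    by (simp only: PP matrix_mul_lid)
  also have "\<dots> = P ** (R ** diag_mat (\<chi> i. f (\<mu> $ i))) ** transpose Q"
    by (simp only: R_def matrix_mul_assoc)
  also have "\<dots> = P ** diag_mat (\<chi> i. f (\<nu> $ i)) ** transpose P ** (Q ** transpose Q)"
    by (simp only: eqf) (simp only: R_def matrix_mul_assoc)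
  finally show ?thesis
    by (simp only: QQ matrix_mul_rid)
qed

lemma spectral_fun_conjugate_diag_mat:
  fixes Q :: "real^'n^'n"
  assumes Q: "orthogonal_matrix Q"
  shows "spectral_fun f (Q ** diag_mat \<mu> ** transpose Q)
       = Q ** diag_mat (\<chi> i. f (\<mu> $ i)) ** transpose Q"
  unfolding spectral_fun_def
proof (rule the_equality)
  fix B assume "\<exists>P \<nu>. orthogonal_matrix P
      \<and> Q ** diag_mat \<mu> ** transpose Q = P ** diag_mat \<nu> ** transpose P
      \<and> B = P ** diag_mat (\<chi> i. f (\<nu> $ i)) ** transpose P"
  then obtain P \<nu> where P: "orthogonal_matrix P"
      and eq: "Q ** diag_mat \<mu> ** transpose Q = P ** diag_mat \<nu> ** transpose P"
      and B: "B = P ** diag_mat (\<chi> i. f (\<nu> $ i)) ** transpose P"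
    by auto
  show "B = Q ** diag_mat (\<chi> i. f (\<mu> $ i)) ** transpose Q"
    unfolding B using conjugate_diag_mat_fun_unique[OF P Q eq, of f] by simp
qed (use Q in blast)

lemma charpoly_diag_mat: "charpoly (diag_mat \<mu>) = (\<Prod>i\<in>UNIV. [:- (\<mu> $ i), 1:])"
  unfolding charpoly_def
  by (subst det_diagonal) (auto simp: diag_mat_def)

text \<open>The scalar matrix \<open>X 1\<close> over the polynomial ring commutes with everything, so conjugation passes
  through \<open>X 1 - A\<close>, and the determinants of \<open>Q\<close> and \<open>Q\<^sup>T\<close> cancel.\<close>

lemma charpoly_conjugate:
  fixes Q A :: "real^'n^'n"
  assumes Q: "orthogonal_matrix Q"
  shows "charpoly (Q ** A ** transpose Q) = charpoly A"
proof -
  define C :: "real^'n^'n \<Rightarrow> real poly^'n^'n" where "C M = (\<chi> i j. [:M $ i $ j:])" for M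
  define X :: "real poly^'n^'n" where "X = (\<chi> i j. if i = j then [:0, 1:] else 0)"
  have pc: "[:\<Sum>k\<in>S. g k:] = (\<Sum>k\<in>S. [:g k:])" for S and g :: "'n \<Rightarrow> real"
    by (induction S rule: infinite_finite_induct) (auto, metis add_0 add_pCons)
  have Cmul: "C (M ** N) = C M ** C N" for M N
    by (simp add: C_def vec_eq_iff matrix_matrix_mult_def pc mult.commute)
  have C1: "C (mat 1) = mat 1"
    by (auto simp: C_def vec_eq_iff mat_def)
  have XC: "X ** M = M ** X" for M
  proof -
    have "(X ** M) $ i $ j = (\<Sum>k\<in>UNIV. if k = i then [:0, 1:] * M $ k $ j else 0)" for i j
      unfolding matrix_matrix_mult_def X_def vec_lambda_beta by (rule sum.cong) auto
    moreover have "(M ** X) $ i $ j = (\<Sum>k\<in>UNIV. if k = j then [:0, 1:] * M $ i $ k else 0)" for i j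
      unfolding matrix_matrix_mult_def X_def vec_lambda_beta by (rule sum.cong) auto
    ultimately show ?thesis by (simp add: vec_eq_iff)
  qed
  have distrib: "L ** (M - N) ** K = L ** M ** K - L ** N ** K" for K L M N :: "real poly^'n^'n"
  proof -
    have "L ** (M - N) = L ** M - L ** N"
      using matrix_add_ldistrib[of L "M - N" N] by (simp add: eq_diff_eq)
    moreover have "(L ** M - L ** N) ** K = L ** M ** K - L ** N ** K"
      by (simp add: vec_eq_iff matrix_matrix_mult_def[of _ K] sum_subtractf left_diff_distrib)
    ultimately show ?thesis by simp
  qed
  have cp: "charpoly M = det (X - C M)" for M
    unfolding charpoly_def X_def C_def
    by (rule arg_cong[of _ _ det]) (simp add: vec_eq_iff)
  have CQ: "C Q ** C (transpose Q) = mat 1"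
    using Q by (simp flip: Cmul add: C1 orthogonal_matrix_def)
  have "X - C (Q ** A ** transpose Q) = C Q ** (X - C A) ** C (transpose Q)"
  proof -
    have "C Q ** (X - C A) ** C (transpose Q) = C Q ** X ** C (transpose Q) - C Q ** C A ** C (transpose Q)"
      by (rule distrib)
    also have "C Q ** X ** C (transpose Q) = X"
      unfolding XC[symmetric] matrix_mul_assoc[symmetric] CQ by (rule matrix_mul_rid)
    finally show ?thesis by (simp add: Cmul)
  qed
  then have "charpoly (Q ** A ** transpose Q) = det (C Q) * det (X - C A) * det (C (transpose Q))"
    by (simp add: cp det_mul)
  also have "\<dots> = det (C Q ** C (transpose Q)) * det (X - C A)"
    by (simp add: det_mul mult_ac)
  finally show ?thesis by (simp add: CQ cp)
qed

lemma eigenvalues_conjugate_diag_mat: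
  assumes "orthogonal_matrix Q"
  shows "eigenvalues (Q ** diag_mat \<mu> ** transpose Q) = image_mset (($) \<mu>) (mset_set UNIV)"
proof -
  have sing: "(\<Sum>i\<in>S. {#f i#}) = image_mset f (mset_set S)" if "finite S" for S :: "'a set" and f :: "'a \<Rightarrow> real"
    using that by (induction S rule: finite_induct) auto
  show ?thesis
  unfolding eigenvalues_def charpoly_conjugate[OF assms] charpoly_diag_mat
  by (subst proots_prod) (auto simp: sing)
qed

lemma size_filter_image_mset_set:
  "size (filter_mset P (image_mset f (mset_set (UNIV :: 'n::finite set)))) = card {i. P (f i)}"
  by (simp add: filter_mset_image_mset)

lemma inertia_conjugate_diag_mat:
  assumes "orthogonal_matrix Q"
  shows "inertia (Q ** diag_mat \<mu> ** transpose Q)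
       = (card {i. \<mu> $ i > 0}, card {i. \<mu> $ i < 0}, card {i. \<mu> $ i = 0})"
  by (simp add: inertia_def eigenvalues_conjugate_diag_mat[OF assms] size_filter_image_mset_set)

lemma eigval_image:
  assumes "transpose (A :: real^'n^'n) = A"
  shows "eigval A ` {1..CARD('n)} = set_mset (eigenvalues A)"
proof -
  obtain Q \<mu> where Q: "orthogonal_matrix Q" and A: "A = Q ** diag_mat \<mu> ** transpose Q"
    using symmetric_matrix_diagonalization[OF assms] .
  define xs where "xs = sorted_list_of_multiset (eigenvalues A)"
  have "length xs = size (eigenvalues A)"
    by (metis xs_def mset_sorted_list_of_multiset size_mset)
  also have "\<dots> = CARD('n)"
    by (simp add: A eigenvalues_conjugate_diag_mat[OF Q])
  finally have len: "length xs = CARD('n)" .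
  have "eigval A ` {1..CARD('n)} = (!) xs ` ((\<lambda>i. i - 1) ` {1..CARD('n)})"
    by (simp add: image_image eigval_def xs_def)
  also have "(\<lambda>i. i - 1) ` {1..CARD('n)} = {..<CARD('n)}"
    by (force simp: image_iff intro!: bexI[of _ "Suc _"])
  also have "(!) xs ` {..<CARD('n)} = set xs"
    using len by (auto simp: set_conv_nth)
  finally show ?thesis by (simp add: xs_def)
qed

text \<open>In the sorted list of eigenvalues everything up to position \<open>k\<close> is below the gap and
  everything after it is above.\<close>

lemma number_of_eigenvalues_below_gap:
  assumes "transpose (A :: real^'n^'n) = A" and k: "k \<in> {1..CARD('n) - 1}"
    and s: "eigval A k < s" "s < eigval A (k + 1)"
  shows "size (filter_mset (\<lambda>x. x < s) (eigenvalues A)) = k"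
    and "s \<notin># eigenvalues A"
proof -
  obtain Q \<mu> where Q: "orthogonal_matrix Q" and A: "A = Q ** diag_mat \<mu> ** transpose Q"
    using symmetric_matrix_diagonalization[OF assms(1)] .
  define xs where "xs = sorted_list_of_multiset (eigenvalues A)"
  have mset: "mset xs = eigenvalues A" by (simp add: xs_def)
  have len: "length xs = CARD('n)"
    unfolding size_mset[symmetric] mset A eigenvalues_conjugate_diag_mat[OF Q] by simp
  have sorted: "sorted xs" by (simp add: xs_def)
  have nth: "xs ! (k - 1) < s" "s < xs ! k"
    using s by (simp_all add: eigval_def xs_def)
  have lo: "xs ! i < s" if "i < k" for i
  proof -
    have "i \<le> k - 1" "k - 1 < length xs" using that len k by auto
    then have "xs ! i \<le> xs ! (k - 1)" by (rule sorted_nth_mono[OF sorted])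
    then show ?thesis using nth by simp
  qed
  have hi: "s < xs ! i" if "k \<le> i" "i < length xs" for i
    using sorted_nth_mono[OF sorted, of k i] nth that by simp
  have "{i. i < length xs \<and> xs ! i < s} = {..<k}"
    using lo hi len k by (force simp: not_less[symmetric])
  then have "length (filter (\<lambda>x. x < s) xs) = k"
    by (simp add: length_filter_conv_card)
  then show "size (filter_mset (\<lambda>x. x < s) (eigenvalues A)) = k"
    unfolding mset[symmetric] mset_filter[symmetric] size_mset .
  have "xs ! i \<noteq> s" if "i < length xs" for i
    using lo[of i] hi[of i] that by (cases "i < k") auto
  then have "s \<notin> set xs"
    unfolding in_set_conv_nth by blast
  then show "s \<notin># eigenvalues A"
    by (simp flip: mset)
qed

text \<open>Of two sublevel sets one contains the other, so for finite ones equal cardinality means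
  equality.\<close>

lemma card_below_eq_iff:
  fixes h :: "'i::finite \<Rightarrow> 'a::linorder"
  shows "card {i. h i < a} = card {i. h i < b} \<longleftrightarrow> (\<forall>i. h i < a \<longleftrightarrow> h i < b)"
proof -
  have "{i. h i < a} = {i. h i < b}" if "card {i. h i < a} = card {i. h i < b}"
  proof (cases "a \<le> b")
    case True
    then have "{i. h i < a} \<subseteq> {i. h i < b}" by auto
    then show ?thesis using that by (intro card_subset_eq) simp_all
  next
    case False
    then have "{i. h i < b} \<subseteq> {i. h i < a}" by auto
    then show ?thesis using that by (intro card_subset_eq[symmetric]) simp_all
  qed
  then show ?thesis by auto
qed

lemma symmetric_shift_scale:
  fixes A :: "real^'n^'n"
  assumes "transpose A = A"
  shows "transpose (a *\<^sub>R (A - s *\<^sub>R mat 1)) = a *\<^sub>R (A - s *\<^sub>R mat 1)"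
proof -
  obtain Q \<mu> where Q: "orthogonal_matrix Q" and A: "A = Q ** diag_mat \<mu> ** transpose Q"
    using symmetric_matrix_diagonalization[OF assms] .
  show ?thesis
    unfolding A conjugate_diag_mat_shift_scale[OF Q] by (rule symmetric_conjugate_diag_mat)
qed

lemma eigenvalues_shift_scale:
  fixes A :: "real^'n^'n"
  assumes "transpose A = A"
  shows "eigenvalues (a *\<^sub>R (A - s *\<^sub>R mat 1)) = image_mset (\<lambda>x. a * (x - s)) (eigenvalues A)"
proof -
  obtain Q \<mu> where Q: "orthogonal_matrix Q" and A: "A = Q ** diag_mat \<mu> ** transpose Q"
    using symmetric_matrix_diagonalization[OF assms] .
  show ?thesis
    unfolding A conjugate_diag_mat_shift_scale[OF Q] eigenvalues_conjugate_diag_mat[OF Q]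
    unfolding multiset.map_comp by (rule image_mset_cong) simp
qed

text \<open>Translates the condition on the indexed eigenvalues, which defines the domain of the filtered
  field, into one on the spectrum of the argument of the filter.\<close>

lemma shifted_eigvals_in_iff:
  fixes A :: "real^'n^'n"
  assumes "transpose A = A"
  shows "(\<forall>i\<in>{1..CARD('n)}. a * (eigval A i - s) \<in> J)
     \<longleftrightarrow> set_mset (eigenvalues (a *\<^sub>R (A - s *\<^sub>R mat 1))) \<subseteq> J"
  unfolding eigenvalues_shift_scale[OF assms] set_image_mset eigval_image[OF assms, symmetric]
  by blast

section \<open>Continuity of the functional calculus\<close>

lemma tendsto_matrix_mult:
  fixes f :: "'a \<Rightarrow> real^'n^'m" and g :: "'a \<Rightarrow> real^'k^'n"
  assumes "(f \<longlongrightarrow> A) F" "(g \<longlongrightarrow> B) F"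
  shows "((\<lambda>x. f x ** g x) \<longlongrightarrow> A ** B) F"
  unfolding matrix_matrix_mult_def by (intro tendsto_intros assms)

lemma tendsto_transpose:
  fixes f :: "'a \<Rightarrow> real^'n^'m"
  assumes "(f \<longlongrightarrow> A) F"
  shows "((\<lambda>x. transpose (f x)) \<longlongrightarrow> transpose A) F"
  unfolding transpose_def by (intro tendsto_intros assms)

lemma tendsto_diag_mat:
  fixes f :: "'a \<Rightarrow> real^'n"
  assumes "(f \<longlongrightarrow> \<mu>) F"
  shows "((\<lambda>x. diag_mat (f x)) \<longlongrightarrow> diag_mat \<mu>) F"
proof -
  have "((\<lambda>x. if i = j then f x $ i else 0) \<longlongrightarrow> (if i = j then \<mu> $ i else 0)) F" for i j
    by (cases "i = j") (auto intro: tendsto_vec_nth assms)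
  then show ?thesis
    unfolding diag_mat_def by (intro tendsto_vec_lambda)
qed

lemma bounded_orthogonal_matrices: "bounded {Q :: real^'n^'n. orthogonal_matrix Q}"
proof -
  have "norm Q \<le> (\<Sum>a\<in>(UNIV :: 'n set). \<Sum>i\<in>(UNIV :: 'n set). 1)"
    if "orthogonal_matrix Q" for Q :: "real^'n^'n"
  proof -
    have entry: "\<bar>Q $ a $ i\<bar> \<le> 1" for a i
    proof -
      have "\<bar>Q $ a $ i\<bar> = \<bar>column i Q $ a\<bar>" by (simp add: column_def)
      also have "\<dots> \<le> norm (column i Q)" by (rule component_le_norm_cart)
      also have "\<dots> = 1" using that by (simp add: orthogonal_matrix_orthonormal_columns)
      finally show ?thesis .
    qed
    have "norm Q \<le> (\<Sum>a\<in>UNIV. norm (Q $ a))"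
      unfolding norm_vec_def by (rule L2_set_le_sum) simp
    also have "\<dots> \<le> (\<Sum>a\<in>UNIV. \<Sum>i\<in>UNIV. \<bar>Q $ a $ i\<bar>)"
      by (intro sum_mono norm_le_l1_cart)
    also have "\<dots> \<le> (\<Sum>a\<in>(UNIV :: 'n set). \<Sum>i\<in>(UNIV :: 'n set). 1)"
      by (intro sum_mono entry)
    finally show ?thesis .
  qed
  then show ?thesis unfolding bounded_iff by blast
qed

text \<open>Only the orthogonal matrices need compactness: the diagonal entries are read off from
  \<open>Q\<^sup>T A Q\<close>, so they converge along the same subsequence.\<close>

lemma diagonalization_limit:
  fixes A Q :: "nat \<Rightarrow> real^'n^'n"
  assumes A: "A \<longlonglongrightarrow> L" and Q: "\<And>n. orthogonal_matrix (Q n)"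
    and eq: "\<And>n. A n = Q n ** diag_mat (\<mu> n) ** transpose (Q n)"
  obtains r P \<nu> where "strict_mono (r :: nat \<Rightarrow> nat)" "orthogonal_matrix P"
    "(\<lambda>n. Q (r n)) \<longlonglongrightarrow> P" "(\<lambda>n. \<mu> (r n)) \<longlonglongrightarrow> \<nu>"
    "L = P ** diag_mat \<nu> ** transpose P"
proof -
  have "bounded (range Q)"
    using bounded_subset[OF bounded_orthogonal_matrices] Q by blast
  then obtain P r where r: "strict_mono (r :: nat \<Rightarrow> nat)" and lim: "(Q \<circ> r) \<longlonglongrightarrow> P"
    using bounded_imp_convergent_subsequence by blast
  then have QP: "(\<lambda>n. Q (r n)) \<longlonglongrightarrow> P" by (simp add: o_def)
  have AL: "(\<lambda>n. A (r n)) \<longlonglongrightarrow> L"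
    using LIMSEQ_subseq_LIMSEQ[OF A r] by (simp add: o_def)
  have QQ: "transpose (Q n) ** Q n = mat 1" for n
    using Q[of n] by (simp add: orthogonal_matrix_def)
  have "(\<lambda>n. transpose (Q (r n)) ** Q (r n)) \<longlonglongrightarrow> transpose P ** P"
    by (intro tendsto_matrix_mult tendsto_transpose QP)
  then have "transpose P ** P = mat 1"
    unfolding QQ by (simp add: LIMSEQ_const_iff)
  then have P: "orthogonal_matrix P" by (simp add: orthogonal_matrix)
  define \<nu> where "\<nu> = (\<chi> i. (transpose P ** L ** P) $ i $ i)"
  have "\<mu> n = (\<chi> i. (transpose (Q n) ** A n ** Q n) $ i $ i)" for n
  proof -
    have "transpose (Q n) ** A n ** Q n
        = (transpose (Q n) ** Q n) ** diag_mat (\<mu> n) ** (transpose (Q n) ** Q n)"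
      unfolding eq by (simp only: matrix_mul_assoc)
    also have "\<dots> = diag_mat (\<mu> n)" by (simp add: QQ)
    finally show ?thesis by (simp add: vec_eq_iff diag_mat_def)
  qed
  moreover have "(\<lambda>n. \<chi> i. (transpose (Q (r n)) ** A (r n) ** Q (r n)) $ i $ i) \<longlonglongrightarrow> \<nu>"
    unfolding \<nu>_def
    by (intro tendsto_vec_lambda tendsto_vec_nth tendsto_matrix_mult tendsto_transpose QP AL)
  ultimately have \<mu>: "(\<lambda>n. \<mu> (r n)) \<longlonglongrightarrow> \<nu>" by simp
  have "(\<lambda>n. A (r n)) \<longlonglongrightarrow> P ** diag_mat \<nu> ** transpose P"
    unfolding eq by (intro tendsto_matrix_mult tendsto_transpose tendsto_diag_mat QP \<mu>)
  then have "L = P ** diag_mat \<nu> ** transpose P"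
    using AL LIMSEQ_unique by blast
  with that r P QP \<mu> show thesis by blast
qed

lemma LIMSEQ_if_subsequences:
  fixes x :: "nat \<Rightarrow> 'a::metric_space"
  assumes "\<And>r :: nat \<Rightarrow> nat. strict_mono r \<Longrightarrow> \<exists>q :: nat \<Rightarrow> nat. strict_mono q \<and> (\<lambda>n. x (r (q n))) \<longlonglongrightarrow> l"
  shows "x \<longlonglongrightarrow> l"
proof (rule ccontr)
  assume "\<not> x \<longlonglongrightarrow> l"
  then obtain e where e: "e > 0" and "\<not> (\<forall>\<^sub>F n in sequentially. dist (x n) l < e)"
    unfolding tendsto_iff by blast
  then have "infinite {n. \<not> dist (x n) l < e}"
    by (simp add: cofinite_eq_sequentially[symmetric] eventually_cofinite)
  then obtain r :: "nat \<Rightarrow> nat" where r: "strict_mono r" "\<And>n. \<not> dist (x (r n)) l < e"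
    using infinite_enumerate by blast
  obtain q :: "nat \<Rightarrow> nat" where "(\<lambda>n. x (r (q n))) \<longlonglongrightarrow> l"
    using assms[OF r(1)] by blast
  then have "\<forall>\<^sub>F n in sequentially. dist (x (r (q n))) l < e"
    using e by (rule tendstoD)
  with r(2) show False by simp
qed

lemma symmetric_sequence_diagonalization:
  fixes A :: "nat \<Rightarrow> real^'n^'n"
  assumes "\<And>n. transpose (A n) = A n"
  obtains Q \<mu> where "\<And>n. orthogonal_matrix (Q n)" "\<And>n. A n = Q n ** diag_mat (\<mu> n) ** transpose (Q n)"
proof -
  have "\<forall>n. \<exists>Q \<mu>. orthogonal_matrix Q \<and> A n = Q ** diag_mat \<mu> ** transpose Q"
    using symmetric_matrix_diagonalization[OF assms] by blast
  then show thesis using that by metis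
qed

text \<open>Every subsequence has a further subsequence along which a diagonalization converges to one of
  the limit matrix; there \<open>f\<close> is applied to finitely many convergent sequences of eigenvalues.
  Hence all cluster points of the values are the value at the limit.\<close>

lemma continuous_on_spectral_fun:
  assumes f: "continuous_on J f"
  shows "continuous_on {A :: real^'n^'n. transpose A = A \<and> set_mset (eigenvalues A) \<subseteq> J} (spectral_fun f)"
  unfolding continuous_on_sequentially o_def
proof safe
  fix A :: "nat \<Rightarrow> real^'n^'n" and L :: "real^'n^'n"
  assume A: "\<forall>n. A n \<in> {A. transpose A = A \<and> set_mset (eigenvalues A) \<subseteq> J}"
    and LJ: "set_mset (eigenvalues L) \<subseteq> J" and lim: "A \<longlonglongrightarrow> L"
  obtain Q \<mu> where Q: "\<And>n. orthogonal_matrix (Q n)"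
      and eq: "\<And>n. A n = Q n ** diag_mat (\<mu> n) ** transpose (Q n)"
    using symmetric_sequence_diagonalization[of A] A by blast
  have \<mu>J: "\<mu> n $ i \<in> J" for n i
  proof -
    have "set_mset (eigenvalues (A n)) \<subseteq> J" using A by blast
    then show ?thesis unfolding eq eigenvalues_conjugate_diag_mat[OF Q] by auto
  qed
  show "(\<lambda>n. spectral_fun f (A n)) \<longlonglongrightarrow> spectral_fun f L"
  proof (rule LIMSEQ_if_subsequences)
    fix r :: "nat \<Rightarrow> nat" assume r: "strict_mono r"
    have lim': "(\<lambda>n. A (r n)) \<longlonglongrightarrow> L"
      using LIMSEQ_subseq_LIMSEQ[OF lim r] by (simp add: o_def)
    obtain q P \<nu> where q: "strict_mono (q :: nat \<Rightarrow> nat)" and P: "orthogonal_matrix P"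
        and QP: "(\<lambda>n. Q (r (q n))) \<longlonglongrightarrow> P" and \<mu>\<nu>: "(\<lambda>n. \<mu> (r (q n))) \<longlonglongrightarrow> \<nu>"
        and L: "L = P ** diag_mat \<nu> ** transpose P"
      by (rule diagonalization_limit[OF lim' Q eq])
    have \<nu>J: "\<nu> $ i \<in> J" for i
      using LJ eigenvalues_conjugate_diag_mat[OF P, of \<nu>] unfolding L by auto
    have "(\<lambda>n. f (\<mu> (r (q n)) $ i)) \<longlonglongrightarrow> f (\<nu> $ i)" for i
      using continuous_on_tendsto_compose[OF f tendsto_vec_nth[OF \<mu>\<nu>] \<nu>J] \<mu>J by simp
    then have "(\<lambda>n. Q (r (q n)) ** diag_mat (\<chi> i. f (\<mu> (r (q n)) $ i)) ** transpose (Q (r (q n))))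
        \<longlonglongrightarrow> P ** diag_mat (\<chi> i. f (\<nu> $ i)) ** transpose P"
      by (intro tendsto_matrix_mult tendsto_transpose tendsto_diag_mat tendsto_vec_lambda QP)
    then show "\<exists>q :: nat \<Rightarrow> nat. strict_mono q \<and> (\<lambda>n. spectral_fun f (A (r (q n)))) \<longlonglongrightarrow> spectral_fun f L"
      using q unfolding L eq spectral_fun_conjugate_diag_mat[OF P] spectral_fun_conjugate_diag_mat[OF Q] by blast
  qed
qed

text \<open>If symmetric matrices tending to \<open>L\<close> had an eigenvalue outside \<open>U\<close>, a subsequence of
  their diagonalizations would converge to one of \<open>L\<close>, whose entries lie in the open set \<open>U\<close>.\<close>

lemma eventually_eigenvalues_subset:
  fixes L :: "real^'n^'n"
  assumes U: "open U" and L: "set_mset (eigenvalues L) \<subseteq> U"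
  shows "\<forall>\<^sub>F A in nhds L. transpose A = A \<longrightarrow> set_mset (eigenvalues A) \<subseteq> U"
proof -
  let ?P = "\<lambda>A :: real^'n^'n. transpose A = A \<longrightarrow> set_mset (eigenvalues A) \<subseteq> U"
  have "\<forall>\<^sub>F n in sequentially. ?P (A n)" if lim: "A \<longlonglongrightarrow> L" for A
  proof (rule ccontr)
    assume "\<not> (\<forall>\<^sub>F n in sequentially. ?P (A n))"
    then have "infinite {n. \<not> ?P (A n)}"
      unfolding cofinite_eq_sequentially[symmetric] eventually_cofinite .
    then obtain r :: "nat \<Rightarrow> nat" where r: "strict_mono r" and bad: "\<And>n. \<not> ?P (A (r n))"
      using infinite_enumerate[of "{n. \<not> ?P (A n)}"] by blast
    have lim': "(\<lambda>n. A (r n)) \<longlonglongrightarrow> L"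
      using LIMSEQ_subseq_LIMSEQ[OF lim r] by (simp add: o_def)
    have "\<And>n. transpose (A (r n)) = A (r n)" using bad by blast
    then obtain Q \<mu> where Q: "\<And>n. orthogonal_matrix (Q n)"
        and eq: "\<And>n. A (r n) = Q n ** diag_mat (\<mu> n) ** transpose (Q n)"
      using symmetric_sequence_diagonalization[of "\<lambda>n. A (r n)"] by blast
    obtain q P \<nu> where P: "orthogonal_matrix P" and \<mu>\<nu>: "(\<lambda>n. \<mu> (q n)) \<longlonglongrightarrow> \<nu>"
        and L_eq: "L = P ** diag_mat \<nu> ** transpose P"
      by (rule diagonalization_limit[OF lim' Q eq])
    have "\<nu> $ i \<in> U" for i
      using L eigenvalues_conjugate_diag_mat[OF P, of \<nu>] unfolding L_eq by auto
    then have "\<forall>\<^sub>F n in sequentially. \<mu> (q n) $ i \<in> U" for i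
      using topological_tendstoD[OF tendsto_vec_nth[OF \<mu>\<nu>, of i] U] by blast
    then have "\<forall>\<^sub>F n in sequentially. \<forall>i. \<mu> (q n) $ i \<in> U"
      by (rule eventually_all_finite)
    then obtain n where "\<forall>i. \<mu> (q n) $ i \<in> U"
      using eventually_happens'[OF sequentially_bot] by blast
    then have "?P (A (r (q n)))"
      unfolding eq eigenvalues_conjugate_diag_mat[OF Q] by auto
    with bad show False by blast
  qed
  then have "\<forall>\<^sub>F A in inf (nhds L) (principal UNIV). ?P A"
    by (intro sequentially_imp_eventually_nhds_within) blast
  then show ?thesis by simp
qed

lemma continuous_on_shifted_spectral_fun:
  fixes H :: "real^'n \<Rightarrow> real^'n^'n"
  assumes cont: "continuous_on UNIV H" and sym: "\<And>x. transpose (H x) = H x"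
    and f: "continuous_on J f"
  shows "continuous_on {x. set_mset (eigenvalues (a *\<^sub>R (H x - s *\<^sub>R mat 1))) \<subseteq> J}
           (\<lambda>x. spectral_fun f (a *\<^sub>R (H x - s *\<^sub>R mat 1)))"
proof (rule continuous_on_compose2[OF continuous_on_spectral_fun[OF f]])
  show "continuous_on {x. set_mset (eigenvalues (a *\<^sub>R (H x - s *\<^sub>R mat 1))) \<subseteq> J} (\<lambda>x. a *\<^sub>R (H x - s *\<^sub>R mat 1))"
    using continuous_on_subset[OF cont subset_UNIV] by (intro continuous_intros)
qed (auto simp: symmetric_shift_scale sym)

lemma shifted_spectrum_interior:
  fixes H :: "real^'n \<Rightarrow> real^'n^'n"
  assumes cont: "continuous_on UNIV H" and sym: "\<And>x. transpose (H x) = H x" and U: "open U"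
    and p: "set_mset (eigenvalues (a *\<^sub>R (H p - s *\<^sub>R mat 1))) \<subseteq> U"
  shows "p \<in> interior {x. set_mset (eigenvalues (a *\<^sub>R (H x - s *\<^sub>R mat 1))) \<subseteq> U}"
proof -
  have "isCont (\<lambda>x. a *\<^sub>R (H x - s *\<^sub>R mat 1)) p"
    using cont by (intro continuous_intros) (simp add: continuous_on_eq_continuous_at)
  then have "filterlim (\<lambda>x. a *\<^sub>R (H x - s *\<^sub>R mat 1)) (nhds (a *\<^sub>R (H p - s *\<^sub>R mat 1))) (nhds p)"
    using tendsto_at_iff_tendsto_nhds[of "\<lambda>x. a *\<^sub>R (H x - s *\<^sub>R mat 1)" p]
    unfolding isCont_def by blast
  from filterlim_iff[THEN iffD1, OF this, rule_format, OF eventually_eigenvalues_subset[OF U p]]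
  have "\<forall>\<^sub>F x in nhds p. set_mset (eigenvalues (a *\<^sub>R (H x - s *\<^sub>R mat 1))) \<subseteq> U"
    by eventually_elim (simp add: symmetric_shift_scale sym)
  then show ?thesis
    unfolding eventually_nhds by (auto simp: interior_def)
qed

section \<open>Gradient and Hessian\<close>

text \<open>Every linear functional on a Euclidean space is the inner product with a unique vector, so the
  description operator in the definition of the gradient denotes the expected vector.\<close>

lemma gradient_has_derivative:
  assumes "E differentiable (at x)"
  shows "(E has_derivative (\<lambda>h. h \<bullet> gradient E x)) (at x)"
proof -
  obtain E' where E': "(E has_derivative E') (at x)"
    using assms by (auto simp: differentiable_def)
  define g where "g = (\<Sum>b\<in>Basis. E' b *\<^sub>R b)"
  interpret linear E' using E' by (rule has_derivative_linear)
  have "E' h = h \<bullet> g" for h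
  proof -
    have "E' h = E' (\<Sum>b\<in>Basis. (h \<bullet> b) *\<^sub>R b)" by (simp add: euclidean_representation)
    also have "\<dots> = h \<bullet> g" by (simp add: sum scale g_def inner_sum_right mult.commute)
    finally show ?thesis .
  qed
  then have "E' = (\<lambda>h. h \<bullet> g)" by blast
  then have g: "GDERIV E x :> g"
    using E' by (simp add: gderiv_def)
  have "gradient E x = g"
    unfolding gradient_def
  proof (rule the_equality)
    show "GDERIV E x :> g" by (rule g)
  next
    fix g' assume "GDERIV E x :> g'"
    then have "(\<lambda>h. h \<bullet> g') = (\<lambda>h. h \<bullet> g)"
      using g unfolding gderiv_def by (rule has_derivative_unique)
    then have "\<forall>h. h \<bullet> g' = h \<bullet> g" by (rule fun_cong[THEN allI])
    then show "g' = g" by (simp add: vector_eq_ldot)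
  qed
  with g show ?thesis by (simp add: gderiv_def)
qed

lemma hessian_has_derivative:
  assumes "gradient E differentiable (at x)"
  shows "(gradient E has_derivative (\<lambda>h. hessian E x *v h)) (at x)"
proof -
  have d: "(gradient E has_derivative frechet_derivative (gradient E) (at x)) (at x)"
    using assms by (simp add: frechet_derivative_works)
  then have "linear (frechet_derivative (gradient E) (at x))"
    by (rule has_derivative_linear)
  then have "(\<lambda>h. hessian E x *v h) = frechet_derivative (gradient E) (at x)"
    unfolding hessian_def by (auto simp: matrix_works)
  with d show ?thesis by simp
qed

lemma has_derivative_along_line:
  fixes f :: "'a::real_normed_vector \<Rightarrow> real"
  assumes "(f has_derivative f') (at (a + t *\<^sub>R w))"
  shows "((\<lambda>t. f (a + t *\<^sub>R w)) has_real_derivative f' w) (at t)"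
proof -
  have "((\<lambda>t. a + t *\<^sub>R w) has_derivative (\<lambda>h. h *\<^sub>R w)) (at t)"
    by (auto intro!: derivative_eq_intros)
  then have "((\<lambda>t. f (a + t *\<^sub>R w)) has_derivative (\<lambda>h. f' (h *\<^sub>R w))) (at t)"
    using has_derivative_compose assms by blast
  moreover have "f' (h *\<^sub>R w) = f' w * h" for h
    using linear_scale[OF has_derivative_linear[OF assms]] by (simp add: mult.commute)
  ultimately show ?thesis
    by (simp add: has_field_derivative_def)
qed

text \<open>The mean value theorem in direction \<open>u\<close>, applied to \<open>E (\<cdot> + v) - E\<close>, followed by the
  mean value theorem in direction \<open>v\<close>, applied to the \<open>u\<close>-component of the gradient.\<close>

lemma second_difference_mean_value:
  assumes E: "twice_continuously_differentiable E"
  obtains \<xi> where "norm (\<xi> - x) \<le> norm u + norm v"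
    "E (x + u + v) - E (x + u) - E (x + v) + E x = u \<bullet> (hessian E \<xi> *v v)"
proof -
  have dE: "(E has_derivative (\<lambda>h. h \<bullet> gradient E y)) (at y)"
    and dG: "(gradient E has_derivative (\<lambda>h. hessian E y *v h)) (at y)" for y
    using E by (intro gradient_has_derivative hessian_has_derivative;
        simp add: twice_continuously_differentiable_def)+
  define f where "f t = E (x + v + t *\<^sub>R u) - E (x + t *\<^sub>R u)" for t :: real
  have df: "(f has_real_derivative u \<bullet> gradient E (x + v + t *\<^sub>R u) - u \<bullet> gradient E (x + t *\<^sub>R u)) (at t)" for t
    unfolding f_def by (intro DERIV_diff has_derivative_along_line dE)
  then obtain a :: real where a: "0 < a" "a < 1"
    and fa: "f 1 - f 0 = (1 - 0) * (u \<bullet> gradient E (x + v + a *\<^sub>R u) - u \<bullet> gradient E (x + a *\<^sub>R u))"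
    using MVT2[OF zero_less_one df] by blast
  define k where "k t = u \<bullet> gradient E (x + a *\<^sub>R u + t *\<^sub>R v)" for t :: real
  have dk: "(k has_real_derivative u \<bullet> (hessian E (x + a *\<^sub>R u + t *\<^sub>R v) *v v)) (at t)" for t
    unfolding k_def
    by (rule has_derivative_along_line[of "\<lambda>y. u \<bullet> gradient E y"]) (intro has_derivative_inner_right dG)
  then obtain b :: real where b: "0 < b" "b < 1"
    and kb: "k 1 - k 0 = (1 - 0) * (u \<bullet> (hessian E (x + a *\<^sub>R u + b *\<^sub>R v) *v v))"
    using MVT2[OF zero_less_one dk] by blast
  show thesis
  proof
    have "norm (a *\<^sub>R u + b *\<^sub>R v) \<le> a * norm u + b * norm v"
      using norm_triangle_ineq[of "a *\<^sub>R u" "b *\<^sub>R v"] a b by simp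
    also have "\<dots> \<le> norm u + norm v"
      using a b by (intro add_mono mult_left_le_one_le) auto
    finally show "norm (x + a *\<^sub>R u + b *\<^sub>R v - x) \<le> norm u + norm v"
      by (simp add: algebra_simps)
    show "E (x + u + v) - E (x + u) - E (x + v) + E x
        = u \<bullet> (hessian E (x + a *\<^sub>R u + b *\<^sub>R v) *v v)"
      using fa kb by (simp add: f_def k_def algebra_simps)
  qed
qed

text \<open>The second difference is symmetric in its two increments \<open>h u\<close> and \<open>h v\<close>, and as \<open>h\<close>
  tends to \<open>0\<close> continuity of the Hessian turns the two mean value expressions of it, divided by
  \<open>h ^ 2\<close>, into the two mixed second derivatives.\<close>

lemma hessian_symmetric:
  fixes E :: "real^'n \<Rightarrow> real"
  assumes E: "twice_continuously_differentiable E"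
  shows "transpose (hessian E x) = hessian E x"
proof -
  have sym: "u \<bullet> (hessian E x *v v) = v \<bullet> (hessian E x *v u)" for u v
  proof -
    define h where "h n = inverse (real (Suc n))" for n
    have h: "h n > 0" for n by (simp add: h_def)
    have h0: "h \<longlonglongrightarrow> 0" unfolding h_def by (rule LIMSEQ_inverse_real_of_nat)
    have ex: "\<forall>n. \<exists>\<xi>. norm (\<xi> - x) \<le> h n * (norm a + norm b) \<and>
        E (x + h n *\<^sub>R a + h n *\<^sub>R b) - E (x + h n *\<^sub>R a) - E (x + h n *\<^sub>R b) + E x
        = (h n)\<^sup>2 * (a \<bullet> (hessian E \<xi> *v b))" (is "\<forall>n. ?ex n") for a b
    proof
      fix n
      obtain \<xi> where near: "norm (\<xi> - x) \<le> norm (h n *\<^sub>R a) + norm (h n *\<^sub>R b)"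
        and diff: "E (x + h n *\<^sub>R a + h n *\<^sub>R b) - E (x + h n *\<^sub>R a) - E (x + h n *\<^sub>R b) + E x
          = (h n *\<^sub>R a) \<bullet> (hessian E \<xi> *v (h n *\<^sub>R b))"
        by (rule second_difference_mean_value[OF E])
      have "norm (h n *\<^sub>R a) + norm (h n *\<^sub>R b) = h n * (norm a + norm b)"
        using h[of n] by (simp add: distrib_left)
      moreover have "(h n *\<^sub>R a) \<bullet> (hessian E \<xi> *v (h n *\<^sub>R b)) = (h n)\<^sup>2 * (a \<bullet> (hessian E \<xi> *v b))"
        by (simp add: matrix_vector_mult_scaleR power2_eq_square)
      ultimately show "?ex n" using near diff by (intro exI[of _ \<xi>] conjI) simp_all
    qed
    obtain \<xi> where \<xi>: "\<And>n. norm (\<xi> n - x) \<le> h n * (norm u + norm v)"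
      "\<And>n. E (x + h n *\<^sub>R u + h n *\<^sub>R v) - E (x + h n *\<^sub>R u) - E (x + h n *\<^sub>R v) + E x
        = (h n)\<^sup>2 * (u \<bullet> (hessian E (\<xi> n) *v v))"
      using choice[OF ex[of u v]] by blast
    obtain \<zeta> where \<zeta>: "\<And>n. norm (\<zeta> n - x) \<le> h n * (norm v + norm u)"
      "\<And>n. E (x + h n *\<^sub>R v + h n *\<^sub>R u) - E (x + h n *\<^sub>R v) - E (x + h n *\<^sub>R u) + E x
        = (h n)\<^sup>2 * (v \<bullet> (hessian E (\<zeta> n) *v u))"
      using choice[OF ex[of v u]] by blast
    have eq: "u \<bullet> (hessian E (\<xi> n) *v v) = v \<bullet> (hessian E (\<zeta> n) *v u)" for n
    proof -
      have "(h n)\<^sup>2 * (u \<bullet> (hessian E (\<xi> n) *v v)) = (h n)\<^sup>2 * (v \<bullet> (hessian E (\<zeta> n) *v u))"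
        unfolding \<xi>(2)[symmetric] \<zeta>(2)[symmetric] by (simp add: add_ac)
      then show ?thesis using h[of n] by simp
    qed
    have lim: "(\<lambda>n. a \<bullet> (hessian E (\<eta> n) *v b)) \<longlonglongrightarrow> a \<bullet> (hessian E x *v b)"
      if \<eta>: "\<And>n. norm (\<eta> n - x) \<le> h n * c" for \<eta> a b c
    proof -
      have "(\<lambda>n. \<eta> n - x) \<longlonglongrightarrow> 0"
      proof (rule Lim_null_comparison)
        show "(\<lambda>n. h n * c) \<longlonglongrightarrow> 0" using tendsto_mult_right[OF h0, of c] by simp
      qed (use \<eta> in simp)
      then have \<eta>x: "\<eta> \<longlonglongrightarrow> x" by (simp add: LIM_zero_iff)
      have "isCont (hessian E) x"
        using E by (simp add: twice_continuously_differentiable_def continuous_on_eq_continuous_at)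
      then have "(\<lambda>n. hessian E (\<eta> n)) \<longlonglongrightarrow> hessian E x"
        using \<eta>x by (rule isCont_tendsto_compose)
      then show ?thesis
        unfolding matrix_vector_mult_def by (intro tendsto_intros)
    qed
    show ?thesis
      using lim[OF \<xi>(1), of u v] lim[OF \<zeta>(1), of v u] LIMSEQ_unique unfolding eq by blast
  qed
  have "hessian E x $ i $ j = hessian E x $ j $ i" for i j
    using sym[of "axis i 1" "axis j 1"]
    by (simp add: matrix_vector_mul_component inner_axis inner_axis' cart_eq_inner_axis[symmetric])
  then show ?thesis by (simp add: vec_eq_iff transpose_def)
qed

section \<open>Linearization of a matrix field applied to a vanishing field\<close>

lemma bounded_bilinear_matrix_vector_mult:
  "bounded_bilinear ((*v) :: real^'n^'m \<Rightarrow> real^'n \<Rightarrow> real^'m)"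
  unfolding bilinear_conv_bounded_bilinear[symmetric] bilinear_def
  by (intro conjI allI linearI)
    (simp_all add: matrix_vector_right_distrib matrix_vector_mult_add_rdistrib
      matrix_vector_mult_scaleR scaleR_matrix_vector_assoc)

text \<open>Split \<open>R x *v g x\<close> into \<open>R p *v g x\<close> and \<open>(R x - R p) *v g x\<close>. In the second term
  \<open>g x\<close> is of the order of \<open>norm (x - p)\<close> and \<open>R x - R p\<close> tends to \<open>0\<close>, so the product is
  \<open>o (norm (x - p))\<close>: continuity of \<open>R\<close> at \<open>p\<close> makes its derivative vanish.\<close>

lemma has_derivative_matrix_mult_vanishing_field:
  fixes R :: "real^'n \<Rightarrow> real^'n^'n" and g :: "real^'n \<Rightarrow> real^'n"
  assumes R: "(R \<longlongrightarrow> R p) (at p within D)"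
    and g: "(g has_derivative (\<lambda>h. H *v h)) (at p within D)" and gp: "g p = 0"
  shows "((\<lambda>x. R x *v g x) has_derivative (\<lambda>h. (R p ** H) *v h)) (at p within D)"
proof -
  interpret mv: bounded_bilinear "(*v) :: real^'n^'n \<Rightarrow> real^'n \<Rightarrow> real^'n"
    by (rule bounded_bilinear_matrix_vector_mult)
  obtain K where K: "K > 0" "\<And>M y. norm (M *v y :: real^'n) \<le> norm (M :: real^'n^'n) * norm y * K"
    using mv.pos_bounded by blast
  obtain d where d: "d > 0" and gd: "\<And>y. y \<in> D \<Longrightarrow> norm (y - p) < d \<Longrightarrow>
      norm (g y - g p - H *v (y - p)) \<le> 1 * norm (y - p)"
    using g zero_less_one unfolding has_derivative_within_alt by blast
  \<comment> \<open>a bound for the slope of \<open>g\<close> at \<open>p\<close>, the \<open>1\<close> accounting for the linearization error\<close>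
  define B where "B = norm H * K + 1"
  have B: "B > 0" using K by (simp add: B_def add_nonneg_pos)
  have gB: "norm (g y) \<le> B * norm (y - p)" if "y \<in> D" "norm (y - p) < d" for y
  proof -
    have "norm (g y) \<le> norm (H *v (y - p)) + norm (g y - g p - H *v (y - p))"
      using norm_triangle_sub[of "g y" "H *v (y - p)"] by (simp add: gp)
    also have "\<dots> \<le> norm H * norm (y - p) * K + 1 * norm (y - p)"
      by (intro add_mono K gd that)
    finally show ?thesis by (simp add: B_def algebra_simps)
  qed
  have "((\<lambda>x. (R x - R p) *v g x) has_derivative (\<lambda>h. 0)) (at p within D)"
    unfolding has_derivative_within_alt
  proof (intro conjI allI impI)
    fix e :: real assume e: "e > 0"
    have KB: "K * B > 0" using K B by simp
    then have "\<forall>\<^sub>F x in at p within D. dist (R x) (R p) < e / (K * B)"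
      using e by (intro tendstoD[OF R]) simp
    then obtain d' where d': "d' > 0" and Rd: "\<And>x. x \<in> D \<Longrightarrow> x \<noteq> p \<Longrightarrow> dist x p < d' \<Longrightarrow> dist (R x) (R p) < e / (K * B)"
      unfolding eventually_at by blast
    have "norm ((R y - R p) *v g y - (R p - R p) *v g p - 0) \<le> e * norm (y - p)"
      if y: "y \<in> D" "norm (y - p) < min d d'" for y
    proof (cases "y = p")
      case False
      have "norm (R y - R p) \<le> e / (K * B)"
        using Rd[OF y(1) False] y(2) by (simp add: dist_norm)
      then have "norm (R y - R p) * norm (g y) * K \<le> e / (K * B) * (B * norm (y - p)) * K"
        using gB[OF y(1)] y(2) K(1) B e by (intro mult_mono) auto
      also have "\<dots> = e * norm (y - p)" using K B by simp
      finally show ?thesis using K(2)[of "R y - R p" "g y"] by (simp add: gp)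
    qed (simp add: gp)
    then show "\<exists>d>0. \<forall>y\<in>D. norm (y - p) < d \<longrightarrow>
        norm ((R y - R p) *v g y - (R p - R p) *v g p - 0) \<le> e * norm (y - p)"
      using d d' by (intro exI[of _ "min d d'"]) simp
  qed simp
  moreover have "((\<lambda>x. R p *v g x) has_derivative (\<lambda>h. R p *v (H *v h))) (at p within D)"
    by (rule bounded_linear.has_derivative[OF mv.bounded_linear_right g])
  ultimately have "((\<lambda>x. (R x - R p) *v g x + R p *v g x) has_derivative (\<lambda>h. 0 + R p *v (H *v h))) (at p within D)"
    by (rule has_derivative_add)
  then show ?thesis
    by (simp add: matrix_vector_mult_diff_rdistrib matrix_vector_mul_assoc)
qed

lemma is_linearization_matrix_times_vanishing_field:
  fixes R :: "real^'n \<Rightarrow> real^'n^'n" and g :: "real^'n \<Rightarrow> real^'n"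
  assumes "p \<in> D" and R: "(R \<longlongrightarrow> R p) (at p within D)"
    and g: "(g has_derivative (\<lambda>h. H *v h)) (at p within D)" and gp: "g p = 0"
  shows "is_linearization (\<lambda>x. - (R x *v g x)) D p (- (R p ** H))"
proof -
  have "(*v) (- (R p ** H)) = (\<lambda>h. - ((R p ** H) *v h))"
    using matrix_vector_mult_diff_rdistrib[of 0 "R p ** H"] by (simp add: fun_eq_iff)
  then show ?thesis
    unfolding is_linearization_def
    using has_derivative_minus[OF has_derivative_matrix_mult_vanishing_field[OF R g gp]] assms(1) gp
    by simp
qed

section \<open>Existence of solutions for bounded continuous fields\<close>

definition euler_point :: "('a::real_vector \<Rightarrow> 'a) \<Rightarrow> 'a \<Rightarrow> real \<Rightarrow> nat \<Rightarrow> 'a" where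
  "euler_point G x0 h i = ((\<lambda>y. y + h *\<^sub>R G y) ^^ i) x0"

text \<open>The deviation from a line of slope \<open>g\<close> grows by at most \<open>h \<epsilon>\<close> in each step. With
  \<open>g = 0\<close> this is a Lipschitz bound for the polygon; with \<open>g\<close> the value of the field at a limit
  point it yields the derivative of the limit.\<close>

lemma euler_point_increment:
  fixes G :: "'a::real_normed_vector \<Rightarrow> 'a"
  assumes "i \<le> j" "h \<ge> 0" and "\<And>l. i \<le> l \<Longrightarrow> l < j \<Longrightarrow> norm (G (euler_point G x0 h l) - g) \<le> \<epsilon>"
  shows "norm (euler_point G x0 h j - euler_point G x0 h i - ((real j - real i) * h) *\<^sub>R g)
           \<le> (real j - real i) * h * \<epsilon>"
  using assms
proof (induction j rule: dec_induct)
  case (step j)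
  let ?z = "euler_point G x0 h"
  have "?z (Suc j) - ?z i - ((real (Suc j) - real i) * h) *\<^sub>R g
      = (?z j - ?z i - ((real j - real i) * h) *\<^sub>R g) + h *\<^sub>R (G (?z j) - g)"
    by (simp add: euler_point_def algebra_simps)
  then have "norm (?z (Suc j) - ?z i - ((real (Suc j) - real i) * h) *\<^sub>R g)
      \<le> norm (?z j - ?z i - ((real j - real i) * h) *\<^sub>R g) + norm (h *\<^sub>R (G (?z j) - g))"
    by (metis norm_triangle_ineq)
  also have "\<dots> \<le> (real j - real i) * h * \<epsilon> + h * \<epsilon>"
    using step by (intro add_mono) (auto simp: mult_left_mono)
  finally show ?case by (simp add: algebra_simps)
qed simp

text \<open>The Euler scheme of step size \<open>1 / N\<close> as a step function. No interpolation is made: the jumps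
  are of size \<open>O(1 / N)\<close> and disappear in the limit.\<close>

definition euler_curve :: "('a::real_vector \<Rightarrow> 'a) \<Rightarrow> 'a \<Rightarrow> real \<Rightarrow> real \<Rightarrow> 'a" where
  "euler_curve G x0 N t = euler_point G x0 (1 / N) (nat \<lfloor>t * N\<rfloor>)"

lemma nat_floor_bounds:
  assumes "t \<ge> 0" "(N::real) > 0"
  shows "real (nat \<lfloor>t * N\<rfloor>) / N \<le> t" "t \<le> real (nat \<lfloor>t * N\<rfloor>) / N + 1 / N"
proof -
  have *: "real (nat \<lfloor>t * N\<rfloor>) = of_int \<lfloor>t * N\<rfloor>"
    using assms by simp
  show "real (nat \<lfloor>t * N\<rfloor>) / N \<le> t"
    unfolding * using assms by (simp add: divide_le_eq)
  show "t \<le> real (nat \<lfloor>t * N\<rfloor>) / N + 1 / N"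
    unfolding * add_divide_distrib[symmetric] using assms
    by (simp add: le_divide_eq)
qed

lemma euler_curve_lipschitz:
  fixes G :: "'a::real_normed_vector \<Rightarrow> 'a"
  assumes M: "\<And>y. norm (G y) \<le> M" and N: "N > 0" and "a \<ge> 0" "b \<ge> 0"
  shows "norm (euler_curve G x0 N b - euler_curve G x0 N a) \<le> M * (\<bar>b - a\<bar> + 1 / N)"
proof -
  have M0: "M \<ge> 0" using M[of 0] norm_ge_zero order_trans by blast
  have le: "norm (euler_curve G x0 N b - euler_curve G x0 N a) \<le> M * (b - a + 1 / N)"
    if "0 \<le> a" "a \<le> b" for a b
  proof -
    let ?i = "nat \<lfloor>a * N\<rfloor>" and ?j = "nat \<lfloor>b * N\<rfloor>"
    have "?i \<le> ?j" using that N by (intro nat_mono floor_mono mult_right_mono) auto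
    then have "norm (euler_curve G x0 N b - euler_curve G x0 N a) \<le> (real ?j - real ?i) * (1 / N) * M"
      using euler_point_increment[of ?i ?j "1 / N" G x0 0 M] M N by (simp add: euler_curve_def)
    also have "\<dots> \<le> (b - a + 1 / N) * M"
    proof (rule mult_right_mono[OF _ M0])
      show "(real ?j - real ?i) * (1 / N) \<le> b - a + 1 / N"
        using nat_floor_bounds[of a N] nat_floor_bounds[of b N] that N by (simp add: diff_divide_distrib)
    qed
    finally show ?thesis by (simp add: mult.commute)
  qed
  show ?thesis
    using le[of a b] le[of b a] assms(3,4) by (cases "a \<le> b") (auto simp: norm_minus_commute)
qed

lemma convergent_if_uniformly_approximated:
  fixes f :: "nat \<Rightarrow> 'a::banach"
  assumes "\<And>e. e > 0 \<Longrightarrow> \<exists>g. convergent g \<and> (\<forall>\<^sub>F n in sequentially. norm (f n - g n) \<le> e)"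
  shows "convergent f"
proof -
  have "Cauchy f"
  proof (rule CauchyI)
    fix e :: real assume e: "e > 0"
    obtain g where g: "convergent g" and ap: "\<forall>\<^sub>F n in sequentially. norm (f n - g n) \<le> e / 4"
      using assms[of "e / 4"] e by auto
    obtain A where A: "\<And>n. n \<ge> A \<Longrightarrow> norm (f n - g n) \<le> e / 4"
      using ap unfolding eventually_sequentially by blast
    have "Cauchy g" using g by (rule convergent_Cauchy)
    then obtain B where B: "\<And>m n. m \<ge> B \<Longrightarrow> n \<ge> B \<Longrightarrow> norm (g m - g n) < e / 4"
      using CauchyD[of g "e / 4"] e by auto
    have "norm (f m - f n) < e" if "m \<ge> max A B" "n \<ge> max A B" for m n
    proof -
      have "f m - f n = (f m - g m) + (g m - g n) - (f n - g n)" by simp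
      then have "norm (f m - f n) \<le> norm (f m - g m) + norm (g m - g n) + norm (f n - g n)"
        using norm_triangle_ineq4[of "(f m - g m) + (g m - g n)" "f n - g n"]
          norm_triangle_ineq[of "f m - g m" "g m - g n"] by simp
      then show ?thesis
        using A[of m] A[of n] B[of m n] that e by simp
    qed
    then show "\<exists>M. \<forall>m\<ge>M. \<forall>n\<ge>M. norm (f m - f n) < e" by blast
  qed
  then show ?thesis by (simp add: Cauchy_convergent_iff)
qed

text \<open>A diagonal subsequence converges at the rational times, and the uniform Lipschitz bound of the
  Euler curves carries convergence over to all times.\<close>

lemma euler_curves_converge:
  fixes G :: "'a::euclidean_space \<Rightarrow> 'a"
  assumes M: "\<And>y. norm (G y) \<le> M"
  obtains r X where "strict_mono (r :: nat \<Rightarrow> nat)"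
    "\<And>t. t \<ge> 0 \<Longrightarrow> (\<lambda>n. euler_curve G x0 (real (Suc (r n))) t) \<longlonglongrightarrow> X t"
proof -
  have M0: "M \<ge> 0" using M[of 0] norm_ge_zero order_trans by blast
  define w where "w n = euler_curve G x0 (real (Suc n))" for n
  have lip: "norm (w n b - w n a) \<le> M * (\<bar>b - a\<bar> + inverse (real (Suc n)))" if "a \<ge> 0" "b \<ge> 0" for n a b
    using euler_curve_lipschitz[OF M, of "real (Suc n)" a b] that by (simp add: w_def inverse_eq_divide)
  have w0: "w n 0 = x0" for n
    by (simp add: w_def euler_curve_def euler_point_def)
  let ?S = "\<rat> \<inter> {0::real..}"
  \<comment> \<open>The curves grow at most linearly in time; dividing by \<open>1 + t\<close> gives the bound uniform in
    \<open>t\<close> that the diagonal argument asks for.\<close>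
  have "norm (w n t /\<^sub>R (1 + t)) \<le> norm x0 + M" if "t \<in> ?S" for n t
  proof -
    have t: "t \<ge> 0" using that by simp
    have "norm (w n t) \<le> norm x0 + norm (w n t - w n 0)"
      using norm_triangle_sub[of "w n t" x0] by (simp add: w0)
    also have "\<dots> \<le> norm x0 + M * (t + 1)"
    proof -
      have "norm (w n t - w n 0) \<le> M * (\<bar>t - 0\<bar> + inverse (real (Suc n)))" by (rule lip[OF order_refl t])
      also have "\<dots> \<le> M * (t + 1)" using t M0 by (intro mult_left_mono) (auto simp: inverse_eq_divide)
      finally show ?thesis by simp
    qed
    also have "\<dots> \<le> (norm x0 + M) * (1 + t)" using t by (simp add: algebra_simps)
    finally show ?thesis using t by (simp add: inverse_eq_divide divide_le_eq)
  qed
  moreover have "countable ?S" by (simp add: countable_rat)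
  ultimately obtain r where r: "strict_mono (r :: nat \<Rightarrow> nat)"
      and conv: "\<And>t. t \<in> ?S \<Longrightarrow> \<exists>l. (\<lambda>n. w (r n) t /\<^sub>R (1 + t)) \<longlonglongrightarrow> l"
    using function_convergent_subsequence[of ?S "\<lambda>n t. w n t /\<^sub>R (1 + t)"] by blast
  have convq: "convergent (\<lambda>n. w (r n) t)" if t: "t \<in> ?S" for t
  proof -
    obtain l where "(\<lambda>n. w (r n) t /\<^sub>R (1 + t)) \<longlonglongrightarrow> l" using conv[OF t] by blast
    then have "(\<lambda>n. (1 + t) *\<^sub>R (w (r n) t /\<^sub>R (1 + t))) \<longlonglongrightarrow> (1 + t) *\<^sub>R l"
      by (intro tendsto_scaleR tendsto_const)
    moreover have "(1 + t) *\<^sub>R (y /\<^sub>R (1 + t)) = y" for y :: 'a using t by simp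
    ultimately have "(\<lambda>n. w (r n) t) \<longlonglongrightarrow> (1 + t) *\<^sub>R l" by simp
    then show ?thesis by (rule convergentI)
  qed
  have "convergent (\<lambda>n. w (r n) t)" if t: "t \<ge> 0" for t
  proof (rule convergent_if_uniformly_approximated)
    fix e :: real assume e: "e > 0"
    \<comment> \<open>\<open>M + 1\<close> instead of \<open>M\<close>, which may be \<open>0\<close>\<close>
    define d where "d = e / (2 * (M + 1))"
    have d: "d > 0" using e M0 by (simp add: d_def)
    obtain q where q: "q \<in> \<rat>" "t < q" "q < t + d"
      using Rats_dense_in_real[of t "t + d"] d by auto
    have "(\<lambda>n. inverse (real (Suc (r n)))) \<longlonglongrightarrow> 0"
      using LIMSEQ_subseq_LIMSEQ[OF LIMSEQ_inverse_real_of_nat r] by (simp add: o_def)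
    then have "\<forall>\<^sub>F n in sequentially. inverse (real (Suc (r n))) < d"
      using d by (rule order_tendstoD)
    then have "\<forall>\<^sub>F n in sequentially. norm (w (r n) t - w (r n) q) \<le> e"
    proof eventually_elim
      case (elim n)
      have "norm (w (r n) t - w (r n) q) \<le> M * (\<bar>t - q\<bar> + inverse (real (Suc (r n))))"
        using t q by (intro lip) auto
      also have "\<dots> \<le> M * (2 * d)" using q elim M0 by (intro mult_left_mono) auto
      also have "\<dots> \<le> (M + 1) * (2 * d)" using d by (intro mult_right_mono) auto
      also have "\<dots> = e" using M0 by (simp add: d_def field_simps)
      finally show ?case .
    qed
    moreover have "convergent (\<lambda>n. w (r n) q)" using convq q t by simp
    ultimately show "\<exists>g. convergent g \<and> (\<forall>\<^sub>F n in sequentially. norm (w (r n) t - g n) \<le> e)"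
      by blast
  qed
  then have "(\<lambda>n. w (r n) t) \<longlonglongrightarrow> lim (\<lambda>n. w (r n) t)" if "t \<ge> 0" for t
    using that by (simp add: convergent_LIMSEQ_iff)
  then show thesis unfolding w_def by (rule that[OF r])
qed

text \<open>Peano's theorem on the half line. The limit of a subsequence of Euler curves is
  differentiable with the right derivative: near time \<open>a\<close> the curves stay close to \<open>X a\<close>, where the
  field is close to \<open>G (X a)\<close> by continuity, so their increments are close to those of a line of
  slope \<open>G (X a)\<close>.\<close>

lemma peano_global_existence:
  fixes G :: "'a::euclidean_space \<Rightarrow> 'a"
  assumes cont: "continuous_on UNIV G" and M: "\<And>y. norm (G y) \<le> M"
  obtains X where "X 0 = x0" "\<And>t. t \<ge> 0 \<Longrightarrow> (X has_vector_derivative G (X t)) (at t within {0..})"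
proof -
  have M0: "M \<ge> 0" using M[of 0] norm_ge_zero order_trans by blast
  obtain r X where r: "strict_mono (r :: nat \<Rightarrow> nat)"
    and lim: "\<And>t. t \<ge> 0 \<Longrightarrow> (\<lambda>n. euler_curve G x0 (real (Suc (r n))) t) \<longlonglongrightarrow> X t"
    by (rule euler_curves_converge[of G M x0, OF M]) (rule that)
  define N where "N n = real (Suc (r n))" for n
  define w where "w n = euler_curve G x0 (N n)" for n
  have N: "N n > 0" for n by (simp add: N_def)
  have wX: "(\<lambda>n. w n t) \<longlonglongrightarrow> X t" if "t \<ge> 0" for t
    using lim[OF that] by (simp add: w_def N_def)
  have N0: "(\<lambda>n. 1 / N n) \<longlonglongrightarrow> 0"
    using LIMSEQ_subseq_LIMSEQ[OF LIMSEQ_inverse_real_of_nat r] by (simp add: o_def N_def inverse_eq_divide)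
  define I where "I n t = nat \<lfloor>t * N n\<rfloor>" for n t
  have I: "real (I n t) / N n \<le> t" "t \<le> real (I n t) / N n + 1 / N n" if "t \<ge> 0" for n t
    using nat_floor_bounds[OF that N] by (simp_all add: I_def)
  have I_lim: "(\<lambda>n. real (I n t) / N n) \<longlonglongrightarrow> t" if "t \<ge> 0" for t
  proof (rule real_tendsto_sandwich)
    show "(\<lambda>n. t - 1 / N n) \<longlonglongrightarrow> t" using tendsto_diff[OF tendsto_const N0, of t] by simp
    show "\<forall>\<^sub>F n in sequentially. t - 1 / N n \<le> real (I n t) / N n"
      using I(2)[OF that] by (simp add: diff_le_eq)
  qed (use I(1)[OF that] in auto)
  have key: "\<exists>\<delta>>0. \<forall>b c. 0 \<le> b \<longrightarrow> b \<le> c \<longrightarrow> \<bar>b - a\<bar> < \<delta> \<longrightarrow> \<bar>c - a\<bar> < \<delta> \<longrightarrow>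
      norm (X c - X b - (c - b) *\<^sub>R G (X a)) \<le> (c - b) * \<epsilon>"
    if a: "a \<ge> 0" and \<epsilon>: "\<epsilon> > 0" for a \<epsilon>
  proof -
    have "isCont G (X a)" using cont by (simp add: continuous_on_eq_continuous_at)
    then obtain d where d: "d > 0" and dG: "\<And>y. dist y (X a) < d \<Longrightarrow> dist (G y) (G (X a)) < \<epsilon>"
      using \<epsilon> unfolding continuous_at_eps_delta by blast
    define \<delta> where "\<delta> = d / (2 * (M + 1))"
    have \<delta>: "\<delta> > 0" using d M0 by (simp add: \<delta>_def)
    have M\<delta>: "M * \<delta> < d / 2"
    proof -
      have "M * \<delta> < (M + 1) * \<delta>" using \<delta> by simp
      also have "\<dots> = d / 2" using M0 by (simp add: \<delta>_def field_simps)
      finally show ?thesis .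
    qed
    show ?thesis
    proof (intro exI[of _ \<delta>] conjI allI impI \<delta>)
      fix b c assume b: "0 \<le> b" and bc: "b \<le> c" and b\<delta>: "\<bar>b - a\<bar> < \<delta>" and c\<delta>: "\<bar>c - a\<bar> < \<delta>"
      \<comment> \<open>The terms of this sequence bound the distance from \<open>X a\<close> of all nodes between the times \<open>b\<close> and
        \<open>c\<close>: one term \<open>1 / N n\<close> for rounding the time down to the grid, the other for the jumps.\<close>
      have "(\<lambda>n. M * (\<delta> + 1 / N n + 1 / N n) + norm (w n a - X a)) \<longlonglongrightarrow> M * (\<delta> + 0 + 0) + norm (X a - X a)"
        by (intro tendsto_intros N0 wX a)
      moreover have "M * (\<delta> + 0 + 0) + norm (X a - X a) < d" using M\<delta> d by simp
      ultimately have "\<forall>\<^sub>F n in sequentially. M * (\<delta> + 1 / N n + 1 / N n) + norm (w n a - X a) < d"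
        by (rule order_tendstoD)
      then have ev: "\<forall>\<^sub>F n in sequentially. norm (w n c - w n b - ((real (I n c) - real (I n b)) * (1 / N n)) *\<^sub>R G (X a))
          \<le> (real (I n c) - real (I n b)) * (1 / N n) * \<epsilon>"
      proof eventually_elim
        case (elim n)
        have "I n b \<le> I n c"
          unfolding I_def using bc N[of n] by (intro nat_mono floor_mono mult_right_mono) auto
        moreover have "norm (G (euler_point G x0 (1 / N n) l) - G (X a)) \<le> \<epsilon>" if l: "I n b \<le> l" "l < I n c" for l
        proof -
          define t where "t = real l / N n"
          have t0: "t \<ge> 0" using N[of n] by (simp add: t_def)
          have wt: "euler_point G x0 (1 / N n) l = w n t"
            using N[of n] by (simp add: w_def euler_curve_def t_def)
          have "real (I n b) / N n \<le> t" "t \<le> real (I n c) / N n"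
            using l N[of n] by (simp_all add: t_def divide_right_mono)
          then have ta: "\<bar>t - a\<bar> \<le> \<delta> + 1 / N n"
            using I[of b n] I[of c n] b bc b\<delta> c\<delta> N[of n] by linarith
          have "dist (w n t) (X a) \<le> norm (w n t - w n a) + norm (w n a - X a)"
            by (metis dist_norm dist_triangle)
          also have "\<dots> \<le> M * (\<bar>t - a\<bar> + 1 / N n) + norm (w n a - X a)"
            using euler_curve_lipschitz[OF M N a t0] by (simp add: w_def)
          also have "\<dots> \<le> M * (\<delta> + 1 / N n + 1 / N n) + norm (w n a - X a)"
            using ta M0 by (intro add_right_mono mult_left_mono) auto
          also have "\<dots> < d" by (rule elim)
          finally show ?thesis using dG[of "w n t"] unfolding wt by (simp add: dist_norm less_imp_le)
        qed
        ultimately show ?case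
          using euler_point_increment[of "I n b" "I n c" "1 / N n" G x0 "G (X a)" \<epsilon>] N[of n]
          by (simp add: w_def euler_curve_def I_def)
      qed
      have c: "0 \<le> c" using b bc by simp
      have h: "(\<lambda>n. (real (I n c) - real (I n b)) * (1 / N n)) \<longlonglongrightarrow> c - b"
        using tendsto_diff[OF I_lim[OF c] I_lim[OF b]] by (simp add: diff_divide_distrib)
      show "norm (X c - X b - (c - b) *\<^sub>R G (X a)) \<le> (c - b) * \<epsilon>"
      proof (rule tendsto_le[OF sequentially_bot _ _ ev])
        show "(\<lambda>n. (real (I n c) - real (I n b)) * (1 / N n) * \<epsilon>) \<longlonglongrightarrow> (c - b) * \<epsilon>"
          by (intro tendsto_mult h tendsto_const)
        show "(\<lambda>n. norm (w n c - w n b - ((real (I n c) - real (I n b)) * (1 / N n)) *\<^sub>R G (X a)))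
            \<longlonglongrightarrow> norm (X c - X b - (c - b) *\<^sub>R G (X a))"
          by (intro tendsto_norm tendsto_diff tendsto_scaleR wX b c h tendsto_const)
      qed
    qed
  qed
  have "(X has_vector_derivative G (X a)) (at a within {0..})" if a: "a \<ge> 0" for a
    unfolding has_vector_derivative_def has_derivative_within_alt
  proof (intro conjI allI impI)
    fix \<epsilon> :: real assume "\<epsilon> > 0"
    then obtain \<delta> where \<delta>: "\<delta> > 0" and inc: "\<And>b c. \<lbrakk>0 \<le> b; b \<le> c; \<bar>b - a\<bar> < \<delta>; \<bar>c - a\<bar> < \<delta>\<rbrakk> \<Longrightarrow>
        norm (X c - X b - (c - b) *\<^sub>R G (X a)) \<le> (c - b) * \<epsilon>"
      using key[OF a] by metis
    have "norm (X y - X a - (y - a) *\<^sub>R G (X a)) \<le> \<epsilon> * norm (y - a)"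
      if y: "y \<ge> 0" "norm (y - a) < \<delta>" for y
    proof (cases "a \<le> y")
      case True
      then show ?thesis using inc[of a y] a y \<delta> by (simp add: mult.commute)
    next
      case False
      then have "norm (X a - X y - (a - y) *\<^sub>R G (X a)) \<le> (a - y) * \<epsilon>"
        using inc[of y a] a y \<delta> by simp
      moreover have "norm (X y - X a - (y - a) *\<^sub>R G (X a)) = norm (X a - X y - (a - y) *\<^sub>R G (X a))"
        by (subst norm_minus_cancel[symmetric]) (simp add: algebra_simps)
      ultimately show ?thesis using False by (simp add: mult.commute)
    qed
    then show "\<exists>d>0. \<forall>y\<in>{0..}. norm (y - a) < d \<longrightarrow>
        norm (X y - X a - (y - a) *\<^sub>R G (X a)) \<le> \<epsilon> * norm (y - a)"
      using \<delta> by auto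
  qed (rule bounded_linear_scaleR_left)
  moreover have "X 0 = x0"
    using wX[of 0] by (simp add: w_def euler_curve_def euler_point_def LIMSEQ_const_iff)
  ultimately show thesis using that by blast
qed

section \<open>Exponential stability from the linearization\<close>

lemma nonincreasing_if_derivative_within:
  fixes f f' :: "real \<Rightarrow> real"
  assumes "a \<le> b" and d: "\<And>t. t \<in> {a..b} \<Longrightarrow> (f has_real_derivative f' t) (at t within {a..b})"
    and "\<And>t. t \<in> {a..b} \<Longrightarrow> f' t \<le> 0"
  shows "f b \<le> f a"
proof (cases "a = b")
  case False
  then have "a < b" using assms(1) by simp
  then obtain t where t: "t \<in> {a<..<b}" "f b - f a = f' t * (b - a)"
    using mvt_simple[of a b f "\<lambda>t h. f' t * h"] d unfolding has_field_derivative_def by auto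
  then have "f' t * (b - a) \<le> 0" using assms(3)[of t] \<open>a < b\<close> by (simp add: mult_nonpos_nonneg)
  then show ?thesis using t(2) by simp
qed simp

text \<open>Inside the ball \<open>exp (2 \<omega> t)\<close> times the squared distance to \<open>p\<close> does not increase. A
  solution cannot leave the ball: at the first time on its boundary the distance would
  be no larger than the initial one, which is smaller than \<open>\<rho>\<close>.\<close>

lemma dissipative_decay:
  fixes x :: "real \<Rightarrow> 'a::real_inner" and F :: "'a \<Rightarrow> 'a"
  assumes dis: "\<And>y. y \<in> cball p \<rho> \<Longrightarrow> F y \<bullet> (y - p) \<le> - \<omega> * ((y - p) \<bullet> (y - p))"
    and \<omega>: "\<omega> > 0"
    and sol: "\<And>t. t \<in> {0..T} \<Longrightarrow> (x has_vector_derivative F (x t)) (at t within {0..T})"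
    and x0: "x 0 \<in> ball p \<rho>" and t: "t \<in> {0..T}"
  shows "norm (x t - p) \<le> exp (- \<omega> * t) * norm (x 0 - p)" and "x t \<in> ball p \<rho>"
proof -
  define V where "V t = (x t - p) \<bullet> (x t - p)" for t
  define W where "W t = exp (2 * \<omega> * t) * V t" for t
  have V0: "V t \<ge> 0" for t by (simp add: V_def)
  have Vnorm: "V t = (norm (x t - p))\<^sup>2" for t by (simp add: V_def power2_norm_eq_inner)
  have dV: "(V has_real_derivative 2 * (F (x t) \<bullet> (x t - p))) (at t within S)"
    if "t \<in> {0..T}" "S \<subseteq> {0..T}" for t S
  proof -
    have "(x has_derivative (\<lambda>h. h *\<^sub>R F (x t))) (at t within S)"
      using sol[OF that(1)] that(2) unfolding has_vector_derivative_def by (rule has_derivative_subset)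
    then have "((\<lambda>t. x t - p) has_derivative (\<lambda>h. h *\<^sub>R F (x t) - 0)) (at t within S)"
      by (intro has_derivative_diff has_derivative_const)
    then have "(V has_derivative (\<lambda>h. (x t - p) \<bullet> (h *\<^sub>R F (x t)) + (h *\<^sub>R F (x t)) \<bullet> (x t - p))) (at t within S)"
      unfolding V_def diff_zero by (intro has_derivative_inner)
    then show ?thesis
      unfolding has_field_derivative_def
      by (rule has_derivative_eq_rhs) (auto simp: inner_commute algebra_simps)
  qed
  have decay: "V b \<le> exp (- (2 * \<omega> * b)) * V 0"
    if b: "0 \<le> b" "b \<le> T" and inside: "\<And>t. 0 \<le> t \<Longrightarrow> t \<le> b \<Longrightarrow> x t \<in> cball p \<rho>" for b
  proof -
    have "W b \<le> W 0"
    proof (rule nonincreasing_if_derivative_within[OF b(1)])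
      fix t assume t: "t \<in> {0..b}"
      then show "(W has_real_derivative
          exp (2 * \<omega> * t) * (2 * \<omega> * V t + 2 * (F (x t) \<bullet> (x t - p)))) (at t within {0..b})"
      proof -
        have "((\<lambda>t. exp (2 * \<omega> * t)) has_real_derivative exp (2 * \<omega> * t) * (2 * \<omega>)) (at t within {0..b})"
          by (auto intro!: derivative_eq_intros)
        moreover have "(V has_real_derivative 2 * (F (x t) \<bullet> (x t - p))) (at t within {0..b})"
          using t b by (intro dV) auto
        ultimately show ?thesis
          unfolding W_def by (rule DERIV_cong[OF DERIV_mult]) (simp add: algebra_simps)
      qed
      have "F (x t) \<bullet> (x t - p) \<le> - \<omega> * V t"
        using dis[of "x t"] inside t by (simp add: V_def)
      then show "exp (2 * \<omega> * t) * (2 * \<omega> * V t + 2 * (F (x t) \<bullet> (x t - p))) \<le> 0"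
        by (intro mult_nonneg_nonpos) auto
    qed
    then have "exp (- (2 * \<omega> * b)) * (exp (2 * \<omega> * b) * V b) \<le> exp (- (2 * \<omega> * b)) * V 0"
      by (simp add: W_def)
    then show ?thesis by (simp add: mult.assoc[symmetric] exp_add[symmetric])
  qed
  have \<rho>: "\<rho> > 0" using x0 by (metis ball_eq_empty empty_iff not_le)
  have in_ball: "x t \<in> ball p \<rho> \<longleftrightarrow> V t < \<rho>\<^sup>2" for t
  proof -
    have "x t \<in> ball p \<rho> \<longleftrightarrow> norm (x t - p) < \<rho>" by (simp add: dist_norm norm_minus_commute)
    also have "\<dots> \<longleftrightarrow> (norm (x t - p))\<^sup>2 < \<rho>\<^sup>2"
      using \<rho> by (meson less_imp_le norm_ge_zero power2_less_imp_less power_strict_mono zero_less_numeral)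
    finally show ?thesis by (simp only: Vnorm)
  qed
  have contV: "continuous_on {0..T} V"
    by (rule DERIV_continuous_on[OF dV]) auto
  have stay: "x t \<in> ball p \<rho>" if t: "t \<in> {0..T}" for t
  proof (rule ccontr)
    assume out: "x t \<notin> ball p \<rho>"
    let ?K = "{0..T} \<inter> V -` {\<rho>\<^sup>2..}"
    have "closed ?K"
      by (intro continuous_closed_preimage contV closed_atLeastAtMost closed_atLeast)
    then have "compact ({0..T} \<inter> ?K)"
      by (intro compact_Int_closed compact_Icc)
    then have "compact ?K"
      by (simp only: Int_left_absorb)
    moreover have "t \<in> ?K" using out t in_ball[of t] by simp
    ultimately obtain b where b: "b \<in> ?K" and first: "\<And>u. u \<in> ?K \<Longrightarrow> b \<le> u"
      using compact_attains_inf[of ?K] by blast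
    have before: "V u < \<rho>\<^sup>2" if "0 \<le> u" "u < b" for u
    proof (rule ccontr)
      assume "\<not> V u < \<rho>\<^sup>2"
      then have "u \<in> ?K" using that b by simp
      then show False using first[of u] that by simp
    qed
    have V0_less: "V 0 < \<rho>\<^sup>2" using x0 in_ball[of 0] by blast
    moreover have "\<rho>\<^sup>2 \<le> V b" using b by simp
    ultimately have "b \<noteq> 0" by auto
    then have b0: "b > 0" using b by simp
    have "V b \<le> \<rho>\<^sup>2"
    proof -
      have "(V \<longlongrightarrow> V b) (at b within {0..b})"
      proof (rule tendsto_within_subset)
        show "(V \<longlongrightarrow> V b) (at b within {0..T})" using contV b unfolding continuous_on_def by blast
      qed (use b in auto)
      then have "(V \<longlongrightarrow> V b) (at_left b)"
        unfolding at_within_Icc_at_left[OF b0] .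
      moreover have "\<forall>\<^sub>F u in at_left b. V u \<le> \<rho>\<^sup>2"
        using eventually_at_left_real[OF b0]
      proof eventually_elim
        case (elim u)
        then show ?case using before[of u] by simp
      qed
      ultimately show ?thesis by (rule tendsto_upperbound) simp
    qed
    have inside: "x u \<in> cball p \<rho>" if "0 \<le> u" "u \<le> b" for u
    proof -
      have "V u \<le> \<rho>\<^sup>2" using before[of u] \<open>V b \<le> \<rho>\<^sup>2\<close> that by (cases "u = b") simp_all
      then have "norm (x u - p) \<le> \<rho>"
        unfolding Vnorm by (rule power2_le_imp_le) (use \<rho> in simp)
      then show ?thesis by (simp add: dist_norm norm_minus_commute)
    qed
    have "b \<le> T" using b by simp
    then have "V b \<le> exp (- (2 * \<omega> * b)) * V 0"
      using inside by (rule decay[OF less_imp_le[OF b0]])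
    also have "\<dots> \<le> 1 * V 0" using \<omega> b0 by (intro mult_right_mono V0) simp
    finally have "V b < \<rho>\<^sup>2" using V0_less by simp
    with \<open>\<rho>\<^sup>2 \<le> V b\<close> show False by simp
  qed
  then show "x t \<in> ball p \<rho>" using t .
  have "V t \<le> exp (- (2 * \<omega> * t)) * V 0"
  proof (rule decay)
    show "x u \<in> cball p \<rho>" if "0 \<le> u" "u \<le> t" for u
      using stay[of u] t that by (intro subsetD[OF ball_subset_cball]) simp
  qed (use t in simp_all)
  also have "\<dots> = (exp (- \<omega> * t) * norm (x 0 - p))\<^sup>2"
    unfolding Vnorm power_mult_distrib exp_double[symmetric] by (simp add: mult.assoc)
  finally show "norm (x t - p) \<le> exp (- \<omega> * t) * norm (x 0 - p)"
    unfolding Vnorm by (rule power2_le_imp_le) simp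
qed

text \<open>On a small ball the linearization error is at most half of the dissipation, so the rate
  \<open>c / 2\<close> survives. For existence the field is composed with the projection \<open>\<pi>\<close> to the ball, which
  makes it bounded and continuous everywhere; a solution of the modified equation never leaves the
  ball and therefore solves the original one.\<close>

lemma locally_exponentially_stable_if_negative_definite:
  fixes F :: "real^'n \<Rightarrow> real^'n"
  assumes lin: "is_linearization F D p A" and int: "p \<in> interior D" and cont: "continuous_on D F"
    and c: "c > 0" and neg: "\<And>\<xi>. (A *v \<xi>) \<bullet> \<xi> \<le> - c * (\<xi> \<bullet> \<xi>)"
  shows "locally_exponentially_stable F D p"
proof -
  have Fp: "F p = 0" and der: "(F has_derivative (\<lambda>\<xi>. A *v \<xi>)) (at p within D)"
    using lin by (auto simp: is_linearization_def)
  obtain d where d: "d > 0"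
    and err: "\<And>y. y \<in> D \<Longrightarrow> norm (y - p) < d \<Longrightarrow> norm (F y - F p - A *v (y - p)) \<le> c / 2 * norm (y - p)"
    using der c unfolding has_derivative_within_alt by (meson half_gt_zero)
  obtain \<rho>' where \<rho>': "\<rho>' > 0" "cball p \<rho>' \<subseteq> D"
    using int by (meson mem_interior_cball)
  define \<rho> where "\<rho> = min \<rho>' (d / 2)"
  have \<rho>: "\<rho> > 0" "cball p \<rho> \<subseteq> D" "\<rho> < d"
    using \<rho>' d by (auto simp: \<rho>_def)
  have dis: "F y \<bullet> (y - p) \<le> - (c / 2) * ((y - p) \<bullet> (y - p))" if y: "y \<in> cball p \<rho>" for y
  proof -
    have "F y \<bullet> (y - p) = (A *v (y - p)) \<bullet> (y - p) + (F y - F p - A *v (y - p)) \<bullet> (y - p)"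
      by (simp add: Fp inner_diff_left)
    also have "\<dots> \<le> - c * ((y - p) \<bullet> (y - p)) + c / 2 * norm (y - p) * norm (y - p)"
    proof (intro add_mono neg)
      have "(F y - F p - A *v (y - p)) \<bullet> (y - p) \<le> norm (F y - F p - A *v (y - p)) * norm (y - p)"
        by (rule norm_cauchy_schwarz)
      also have "\<dots> \<le> c / 2 * norm (y - p) * norm (y - p)"
        using y \<rho> by (intro mult_right_mono err) (auto simp: dist_norm norm_minus_commute)
      finally show "(F y - F p - A *v (y - p)) \<bullet> (y - p) \<le> c / 2 * norm (y - p) * norm (y - p)" .
    qed
    also have "\<dots> = - (c / 2) * ((y - p) \<bullet> (y - p))"
      by (simp add: power2_norm_eq_inner[symmetric] power2_eq_square)
    finally show ?thesis .
  qed
  define \<pi> where "\<pi> = closest_point (cball p \<rho>)"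
  have \<pi>_in: "\<pi> y \<in> cball p \<rho>" for y
    unfolding \<pi>_def using \<rho> by (intro closest_point_in_set) auto
  have \<pi>_id: "\<pi> y = y" if "y \<in> cball p \<rho>" for y
    unfolding \<pi>_def using that by (rule closest_point_self)
  define G where "G = F \<circ> \<pi>"
  have GF: "G y = F y" if "y \<in> cball p \<rho>" for y using \<pi>_id[OF that] by (simp add: G_def)
  have contF: "continuous_on (cball p \<rho>) F" using cont \<rho>(2) by (rule continuous_on_subset)
  have "continuous_on UNIV \<pi>"
    unfolding \<pi>_def using \<rho> by (intro continuous_on_closest_point) auto
  then have contG: "continuous_on UNIV G"
    unfolding G_def using contF \<pi>_in by (intro continuous_on_compose) (auto intro: continuous_on_subset)
  have "bounded (F ` cball p \<rho>)"
    using contF by (intro compact_imp_bounded compact_continuous_image) auto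
  then obtain M where "\<And>y. y \<in> cball p \<rho> \<Longrightarrow> norm (F y) \<le> M"
    unfolding bounded_iff by blast
  then have M: "norm (G y) \<le> M" for y
    using \<pi>_in by (simp add: G_def)
  have "\<exists>x. is_solution F D {0..} x \<and> x 0 = x0" if x0: "x0 \<in> ball p \<rho>" for x0
  proof -
    obtain x where xz: "x 0 = x0" and xG: "\<And>t. t \<ge> 0 \<Longrightarrow> (x has_vector_derivative G (x t)) (at t within {0..})"
      using peano_global_existence[OF contG M] by metis
    have "x t \<in> ball p \<rho>" if "t \<ge> 0" for t
    proof (rule dissipative_decay(2)[where F = G and T = t and \<omega> = "c / 2"])
      show "(x has_vector_derivative G (x u)) (at u within {0..t})" if "u \<in> {0..t}" for u
        using xG[of u] that by (auto intro: has_vector_derivative_within_subset)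
    qed (use dis GF c xz x0 that in auto)
    then have "is_solution F D {0..} x"
      unfolding is_solution_def using xG GF \<rho>(2) by (metis atLeast_iff ball_subset_cball subsetD)
    with xz show ?thesis by blast
  qed
  moreover have "norm (x t - p) \<le> 1 * exp (- (c / 2) * t) * norm (x0 - p)"
    if "x0 \<in> ball p \<rho>" "is_solution F D {0..T} x" "x 0 = x0" "t \<in> {0..T}" for x0 T x t
    using dissipative_decay(1)[where F = F and x = x and T = T and \<omega> = "c / 2", OF dis] that c
    by (simp add: is_solution_def)
  ultimately show ?thesis
    unfolding locally_exponentially_stable_def using \<rho>(1) c
    by (intro exI[of _ \<rho>] conjI exI[of _ 1] exI[of _ "c / 2"] ballI allI impI) auto
qed

text \<open>Start at distance \<open>\<epsilon>\<close> from \<open>p\<close> in direction \<open>v\<close> and follow the component \<open>z\<close> of \<open>x - p\<close>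
  along \<open>v\<close>. While \<open>norm (x - p) \<le> C \<epsilon>\<close>, which stability guarantees, the linearization error is at
  most \<open>\<kappa> \<epsilon> / 2\<close>, so that \<open>z' \<ge> \<kappa> (z - \<epsilon> / 2)\<close> and \<open>z\<close> never drops below its initial value
  \<open>\<epsilon>\<close>. But stability forces \<open>norm (x - p) < \<epsilon>\<close> at the time \<open>T\<close>, which does not depend on
  \<open>\<epsilon>\<close>.\<close>

lemma not_locally_exponentially_stable_if_unstable_direction:
  fixes F :: "real^'n \<Rightarrow> real^'n"
  assumes lin: "is_linearization F D p A" 
    and \<kappa>: "\<kappa> > 0" and v: "norm v = 1" and eig: "\<And>\<xi>. (A *v \<xi>) \<bullet> v = \<kappa> * (\<xi> \<bullet> v)"
  shows "\<not> locally_exponentially_stable F D p"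
proof
  assume "locally_exponentially_stable F D p"
  then obtain r C \<omega> where r: "r > 0" and C: "C > 0" and \<omega>: "\<omega> > 0"
    and stable: "\<forall>x0\<in>ball p r. (\<exists>x. is_solution F D {0..} x \<and> x 0 = x0) \<and>
        (\<forall>T>0. \<forall>x. is_solution F D {0..T} x \<and> x 0 = x0 \<longrightarrow>
           (\<forall>t\<in>{0..T}. norm (x t - p) \<le> C * exp (- \<omega> * t) * norm (x0 - p)))"
    unfolding locally_exponentially_stable_def by (elim exE conjE) (rule that)
  have Fp: "F p = 0" and der: "(F has_derivative (\<lambda>\<xi>. A *v \<xi>)) (at p within D)"
    using lin by (auto simp: is_linearization_def)
  obtain d where d: "d > 0" and err: "\<And>y. y \<in> D \<Longrightarrow> norm (y - p) < d \<Longrightarrow>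
      norm (F y - F p - A *v (y - p)) \<le> \<kappa> / (2 * C) * norm (y - p)"
  proof -
    have "\<kappa> / (2 * C) > 0" using \<kappa> C by simp
    then show thesis using der that unfolding has_derivative_within_alt by blast
  qed
  \<comment> \<open>any time at which the decay factor \<open>C * exp (- \<omega> * T)\<close> is below \<open>1\<close>\<close>
  define T where "T = (\<bar>ln C\<bar> + 1) / \<omega>"
  have T: "T > 0" using \<omega> by (simp add: T_def add_nonneg_pos)
  have small: "C * exp (- \<omega> * T) < 1"
  proof -
    have "C * exp (- \<omega> * T) = exp (ln C - \<omega> * T)"
      using C by (simp add: exp_diff exp_minus divide_inverse)
    also have "\<dots> < exp 0" using \<omega> by (subst exp_less_cancel_iff) (simp add: T_def)
    finally show ?thesis by simp
  qed
  \<comment> \<open>starts within the stability radius and keeps \<open>C * \<epsilon>\<close>, hence the whole solution, within the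
    range of the linearization estimate\<close>
  define \<epsilon> where "\<epsilon> = min r (d / C) / 2"
  have \<epsilon>: "\<epsilon> > 0" "\<epsilon> < r" "C * \<epsilon> < d"
  proof -
    have m: "0 < min r (d / C)" using r d C by simp
    then show "\<epsilon> > 0" by (simp add: \<epsilon>_def)
    have "\<epsilon> < min r (d / C)" unfolding \<epsilon>_def using add_strict_left_mono[OF half_gt_zero[OF m], of "min r (d / C) / 2"]
      by (simp only: field_sum_of_halves add_0_right)
    then have "\<epsilon> < r" "\<epsilon> < d / C" by simp_all
    then show "\<epsilon> < r" "C * \<epsilon> < d" using C by (simp_all add: pos_less_divide_eq mult.commute)
  qed
  define x0 where "x0 = p + \<epsilon> *\<^sub>R v"
  have x0: "norm (x0 - p) = \<epsilon>" "x0 \<in> ball p r"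
    using v \<epsilon> by (auto simp: x0_def dist_norm)
  obtain x where sol: "is_solution F D {0..} x" and xz: "x 0 = x0"
    using stable x0(2) by blast
  have solT: "is_solution F D {0..T} x"
    unfolding is_solution_def
  proof (intro ballI conjI)
    fix t assume "t \<in> {0..T}"
    then have "x t \<in> D" and "(x has_vector_derivative F (x t)) (at t within {0..})"
      using sol by (auto simp: is_solution_def)
    then show "x t \<in> D" and "(x has_vector_derivative F (x t)) (at t within {0..T})"
      by (auto intro: has_vector_derivative_within_subset[where S = "{0..}"])
  qed
  have bd: "norm (x t - p) \<le> C * exp (- \<omega> * t) * \<epsilon>" if "t \<in> {0..T}" for t
  proof -
    have "\<forall>t\<in>{0..T}. norm (x t - p) \<le> C * exp (- \<omega> * t) * norm (x0 - p)"
      using bspec[OF stable x0(2)] T solT xz by blast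
    then show ?thesis using that unfolding x0(1) by blast
  qed
  define z where "z t = (x t - p) \<bullet> v" for t
  define Y where "Y t = exp (- \<kappa> * t) * (\<epsilon> / 2 - z t)" for t
  have "Y T \<le> Y 0"
  proof (rule nonincreasing_if_derivative_within[where f = Y and a = 0 and b = T])
    fix t assume t: "t \<in> {0..T}"
    have xD: "x t \<in> D" and xd: "(x has_vector_derivative F (x t)) (at t within {0..T})"
      using solT t by (auto simp: is_solution_def)
    have "(z has_derivative (\<lambda>h. (h *\<^sub>R F (x t)) \<bullet> v)) (at t within {0..T})"
    proof -
      have "((\<lambda>t. x t - p) has_derivative (\<lambda>h. h *\<^sub>R F (x t) - 0)) (at t within {0..T})"
        using xd unfolding has_vector_derivative_def by (intro has_derivative_diff has_derivative_const)
      then show ?thesis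
        unfolding z_def diff_zero by (rule has_derivative_inner_left)
    qed
    then have zd: "(z has_real_derivative F (x t) \<bullet> v) (at t within {0..T})"
      unfolding has_field_derivative_def by (rule has_derivative_eq_rhs) (auto simp: mult.commute)
    show "(Y has_real_derivative exp (- \<kappa> * t) * (- \<kappa> * (\<epsilon> / 2 - z t) - F (x t) \<bullet> v)) (at t within {0..T})"
    proof -
      have "((\<lambda>t. exp (- \<kappa> * t)) has_real_derivative exp (- \<kappa> * t) * (- \<kappa>)) (at t within {0..T})"
        by (auto intro!: derivative_eq_intros)
      moreover have "((\<lambda>t. \<epsilon> / 2 - z t) has_real_derivative 0 - F (x t) \<bullet> v) (at t within {0..T})"
        by (intro DERIV_diff DERIV_const zd)
      ultimately show ?thesis
        unfolding Y_def by (rule DERIV_cong[OF DERIV_mult]) (simp add: algebra_simps)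
    qed
    have xb: "norm (x t - p) \<le> C * \<epsilon>"
    proof -
      have "C * exp (- \<omega> * t) * \<epsilon> \<le> C * 1 * \<epsilon>"
        using t \<omega> C \<epsilon> by (intro mult_right_mono mult_left_mono) auto
      with bd[OF t] show ?thesis by simp
    qed
    have "\<bar>F (x t) \<bullet> v - \<kappa> * z t\<bar> = \<bar>(F (x t) - F p - A *v (x t - p)) \<bullet> v\<bar>"
      unfolding Fp diff_zero inner_diff_left[of "F (x t)"] eig z_def ..
    also have "\<dots> \<le> norm (F (x t) - F p - A *v (x t - p)) * norm v"
      by (rule Cauchy_Schwarz_ineq2)
    also have "\<dots> \<le> \<kappa> / (2 * C) * norm (x t - p)"
      using err[OF xD] xb \<epsilon> v by simp
    also have "\<dots> \<le> \<kappa> / (2 * C) * (C * \<epsilon>)"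
      using xb \<kappa> C by (intro mult_left_mono) auto
    also have "\<dots> = \<kappa> * (\<epsilon> / 2)" using C by simp
    finally have "- \<kappa> * (\<epsilon> / 2 - z t) - F (x t) \<bullet> v \<le> 0"
      unfolding right_diff_distrib mult_minus_left by linarith
    then show "exp (- \<kappa> * t) * (- \<kappa> * (\<epsilon> / 2 - z t) - F (x t) \<bullet> v) \<le> 0"
      by (intro mult_nonneg_nonpos) auto
  qed (use T in simp)
  moreover have "Y 0 = - (\<epsilon> / 2)"
  proof -
    have "x 0 - p = \<epsilon> *\<^sub>R v" by (simp add: xz x0_def)
    moreover have "v \<bullet> v = 1" using v by (simp add: dot_square_norm)
    ultimately have "z 0 = \<epsilon>" by (simp add: z_def)
    then show ?thesis by (simp add: Y_def)
  qed
  ultimately have "exp (- \<kappa> * T) * (\<epsilon> / 2 - z T) \<le> - (\<epsilon> / 2)" by (simp only: Y_def)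
  then have "exp (\<kappa> * T) * (exp (- \<kappa> * T) * (\<epsilon> / 2 - z T)) \<le> exp (\<kappa> * T) * - (\<epsilon> / 2)"
    by (rule mult_left_mono) simp
  moreover have "exp (\<kappa> * T) * (exp (- \<kappa> * T) * y) = y" for y
    by (simp add: exp_minus)
  ultimately have "\<epsilon> / 2 - z T \<le> - (exp (\<kappa> * T) * (\<epsilon> / 2))"
    by (simp only: mult_minus_right)
  moreover have "1 * (\<epsilon> / 2) \<le> exp (\<kappa> * T) * (\<epsilon> / 2)"
    using \<kappa> T \<epsilon> by (intro mult_right_mono) auto
  ultimately have "\<epsilon> \<le> z T" by linarith
  also have "z T \<le> norm (x T - p) * norm v"
    unfolding z_def by (rule norm_cauchy_schwarz)
  also have "\<dots> = norm (x T - p)" by (simp only: v mult_1_right)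
  also have "\<dots> \<le> C * exp (- \<omega> * T) * \<epsilon>" using T by (intro bd) simp
  also have "\<dots> < 1 * \<epsilon>" using small \<epsilon>(1) by (rule mult_strict_right_mono)
  finally show False by simp
qed

text \<open>The eigenvalues are the entries of \<open>\<mu>\<close>: the largest of them bounds the quadratic form, and a
  positive one gives an unstable direction, since an eigenvector of a symmetric matrix is also a
  left eigenvector.\<close>

lemma symmetric_linearization_stability:
  fixes F :: "real^'n \<Rightarrow> real^'n"
  assumes Q: "orthogonal_matrix Q" and lin: "is_linearization F D p (Q ** diag_mat \<mu> ** transpose Q)"
    and int: "p \<in> interior D" and cont: "continuous_on D F" and nz: "\<And>i. \<mu> $ i \<noteq> 0"
  shows "locally_exponentially_stable F D p \<longleftrightarrow> (\<forall>i. \<mu> $ i < 0)"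
proof
  assume neg: "\<forall>i. \<mu> $ i < 0"
  define c where "c = - Max (range (($) \<mu>))"
  have "Max (range (($) \<mu>)) \<in> range (($) \<mu>)" by (rule Max_in) auto
  then have c: "c > 0" using neg by (auto simp: c_def)
  have "\<mu> $ i \<le> Max (range (($) \<mu>))" for i by (rule Max_ge) auto
  then have "\<mu> $ i \<le> - c" for i by (simp only: c_def minus_minus)
  then show "locally_exponentially_stable F D p"
    by (intro locally_exponentially_stable_if_negative_definite[OF lin int cont c]
        inner_conjugate_diag_mat_le Q)
next
  assume stable: "locally_exponentially_stable F D p"
  show "\<forall>i. \<mu> $ i < 0"
  proof (rule ccontr)
    assume "\<not> (\<forall>i. \<mu> $ i < 0)"
    then obtain i where "\<mu> $ i > 0" using nz by (meson linorder_neqE_linordered_idom)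
    moreover have "norm (column i Q) = 1"
      using Q by (simp add: orthogonal_matrix_orthonormal_columns)
    moreover have "((Q ** diag_mat \<mu> ** transpose Q) *v \<xi>) \<bullet> column i Q = \<mu> $ i * (\<xi> \<bullet> column i Q)" for \<xi>
      unfolding symmetric_matrix_inner[OF symmetric_conjugate_diag_mat] conjugate_diag_mat_column[OF Q]
      by simp
    ultimately have "\<not> locally_exponentially_stable F D p"
      by (rule not_locally_exponentially_stable_if_unstable_direction[OF lin])
    then show False using stable by contradiction
  qed
qed

section \<open>Shifted-sign and filtered dynamics\<close>

theorem theorem3p1:
  fixes E :: "real^'n \<Rightarrow> real" and J :: "real set" and \<phi> :: "real \<Rightarrow> real"
    and \<alpha> s :: real and k j :: nat and p :: "real^'n"
  assumes E: "twice_continuously_differentiable E"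
    and J: "is_interval J"
    and filter: "sign_preserving_filter J \<phi>"
    and p: "nondegenerate_critical_point E p"
    and j: "morse_index E p = j"
    and k: "k \<in> {1..CARD('n) - 1}"
    and s: "eigval (hessian E p) k < s" "s < eigval (hessian E p) (k + 1)"
    and \<alpha>: "\<alpha> > 0" "\<forall>i\<in>{1..CARD('n)}. \<alpha> * (eigval (hessian E p) i - s) \<in> J"
  shows
    "(let L = - (filtered_reflector \<phi> \<alpha> s (hessian E p) ** hessian E p);
          M = - (shifted_sign s (hessian E p) ** hessian E p);
          F = filtered_field \<phi> \<alpha> s E;
          D = filtered_domain J \<alpha> s E
      in is_linearization F D p L
         \<and> is_linearization (sign_field s E) UNIV p M
         \<and> inertia L = inertia M
         \<and> (p \<in> interior D \<longrightarrow> (locally_exponentially_stable F D p \<longleftrightarrow> j = k))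
         \<and> ((\<forall>i\<in>{1..CARD('n)}. \<alpha> * (eigval (hessian E p) i - s) \<in> interior J)
              \<longrightarrow> p \<in> interior D))"
proof -
  let ?H = "hessian E"
  define L where "L = - (filtered_reflector \<phi> \<alpha> s (?H p) ** ?H p)"
  define M where "M = - (shifted_sign s (?H p) ** ?H p)"
  define F where "F = filtered_field \<phi> \<alpha> s E"
  define D where "D = filtered_domain J \<alpha> s E"
  note sym = hessian_symmetric[OF E]
  have contH: "continuous_on UNIV ?H"
    and dg: "(gradient E has_derivative (\<lambda>h. ?H x *v h)) (at x within S)" for x S
    using E hessian_has_derivative has_derivative_at_withinI
    unfolding twice_continuously_differentiable_def by blast+
  have gp: "gradient E p = 0" and inv: "invertible (?H p)"
    using p by (auto simp: nondegenerate_critical_point_def)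
  have cont\<phi>: "continuous_on J \<phi>" and \<phi>pos: "\<And>t. t \<in> J \<Longrightarrow> t \<noteq> 0 \<Longrightarrow> \<phi> t * t > 0"
    using filter by (auto simp: sign_preserving_filter_def)

  have D: "D = {x. set_mset (eigenvalues (\<alpha> *\<^sub>R (?H x - s *\<^sub>R mat 1))) \<subseteq> J}"
    unfolding D_def filtered_domain_def shifted_eigvals_in_iff[OF sym] ..
  have pD: "p \<in> D"
    using \<alpha>(2) unfolding D shifted_eigvals_in_iff[OF sym] by simp
  have contR: "continuous_on D (\<lambda>x. filtered_reflector \<phi> \<alpha> s (?H x))"
    unfolding D filtered_reflector_def by (rule continuous_on_shifted_spectral_fun[OF contH sym cont\<phi>])
  have F: "F = (\<lambda>x. - (filtered_reflector \<phi> \<alpha> s (?H x) *v gradient E x))"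
    by (simp add: F_def filtered_field_def fun_eq_iff)
  have linF: "is_linearization F D p L"
    unfolding F L_def using contR pD
    by (intro is_linearization_matrix_times_vanishing_field dg gp) (auto simp: continuous_on_def)

  obtain Q h where Q: "orthogonal_matrix Q" and Hp: "?H p = Q ** diag_mat h ** transpose Q"
    using symmetric_matrix_diagonalization[OF sym] .
  have eigH: "eigenvalues (?H p) = image_mset (($) h) (mset_set UNIV)"
    unfolding Hp by (rule eigenvalues_conjugate_diag_mat[OF Q])
  note gap = number_of_eigenvalues_below_gap[OF sym k s]
  have hs: "h $ i \<noteq> s" for i using gap(2) by (auto simp: eigH)
  have h0: "h $ i \<noteq> 0" for i
    using inv unfolding Hp by (rule invertible_conjugate_diag_mat_nonzero)
  have hJ: "\<alpha> * (h $ i - s) \<in> J" for i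
  proof -
    have "h $ i \<in># eigenvalues (?H p)" by (simp add: eigH)
    then have "\<alpha> * (h $ i - s) \<in># eigenvalues (\<alpha> *\<^sub>R (?H p - s *\<^sub>R mat 1))"
      unfolding eigenvalues_shift_scale[OF sym] set_image_mset by (rule imageI)
    then show ?thesis using pD unfolding D by blast
  qed

  \<comment> \<open>The sign is discontinuous at \<open>0\<close>, so it is used on \<open>- {0}\<close>, which contains the shifted
    spectrum at all points near \<open>p\<close>. The factor \<open>1\<close> makes the lemmas on scaled shifts apply.\<close>
  define S where "S = {x. set_mset (eigenvalues (1 *\<^sub>R (?H x - s *\<^sub>R mat 1))) \<subseteq> - {0}}"
  have "set_mset (eigenvalues (1 *\<^sub>R (?H p - s *\<^sub>R mat 1))) \<subseteq> - {0}"
    unfolding eigenvalues_shift_scale[OF sym] using hs by (auto simp: eigH)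
  then have pS: "p \<in> interior S"
    unfolding S_def by (intro shifted_spectrum_interior[OF contH sym]) auto
  have "continuous_on (- {0::real}) sgn"
    by (intro continuous_on_sgn continuous_on_id) auto
  then have "continuous_on S (\<lambda>x. shifted_sign s (?H x))"
    using continuous_on_shifted_spectral_fun[OF contH sym, of "- {0}" sgn 1 s]
    by (simp add: S_def shifted_sign_def)
  then have "isCont (\<lambda>x. shifted_sign s (?H x)) p"
    using pS by (rule continuous_on_interior)
  then have linM: "is_linearization (sign_field s E) UNIV p M"
    unfolding sign_field_def[abs_def] M_def
    by (intro is_linearization_matrix_times_vanishing_field dg gp) (auto simp: isCont_def)

  define l where "l = (\<chi> i. - (\<phi> (\<alpha> * (h $ i - s)) * h $ i))"
  define m where "m = (\<chi> i. - (sgn (h $ i - s) * h $ i))"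
  have L: "L = Q ** diag_mat l ** transpose Q"
    unfolding L_def filtered_reflector_def Hp conjugate_diag_mat_shift_scale[OF Q]
      spectral_fun_conjugate_diag_mat[OF Q] conjugate_diag_mat_mult[OF Q] uminus_conjugate_diag_mat
    by (rule arg_cong[of _ _ "\<lambda>v. Q ** diag_mat v ** transpose Q"]) (simp add: l_def vec_eq_iff)
  have shift: "?H p - s *\<^sub>R mat 1 = Q ** diag_mat (\<chi> i. h $ i - s) ** transpose Q"
    using conjugate_diag_mat_shift_scale[OF Q, of 1 h s] by (simp add: Hp)
  have M: "M = Q ** diag_mat m ** transpose Q"
    unfolding M_def shifted_sign_def shift spectral_fun_conjugate_diag_mat[OF Q]
    unfolding Hp conjugate_diag_mat_mult[OF Q] uminus_conjugate_diag_mat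
    by (rule arg_cong[of _ _ "\<lambda>v. Q ** diag_mat v ** transpose Q"]) (simp add: m_def vec_eq_iff)
  have \<phi>sgn: "sgn (\<phi> (\<alpha> * (h $ i - s))) = sgn (h $ i - s)" for i
  proof -
    have "\<phi> (\<alpha> * (h $ i - s)) * (\<alpha> * (h $ i - s)) > 0"
      using hs[of i] \<alpha>(1) by (intro \<phi>pos hJ) simp
    then show ?thesis
      using \<alpha>(1) by (auto simp: sgn_real_def zero_less_mult_iff mult_less_0_iff)
  qed
  have sgn_lm: "sgn (l $ i) = sgn (m $ i)" for i
    by (simp add: l_def m_def sgn_mult \<phi>sgn)
  have "inertia L = inertia M"
  proof -
    have "l $ i > 0 \<longleftrightarrow> m $ i > 0" "l $ i < 0 \<longleftrightarrow> m $ i < 0" "l $ i = 0 \<longleftrightarrow> m $ i = 0" for i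
      using sgn_lm[of i] by (metis sgn_greater, metis sgn_less, metis sgn_0_0)
    then show ?thesis unfolding L M inertia_conjugate_diag_mat[OF Q] by simp
  qed

  have l_neg: "l $ i < 0 \<longleftrightarrow> (h $ i < 0 \<longleftrightarrow> h $ i < s)" and l_nz: "l $ i \<noteq> 0" for i
  proof -
    have "sgn (l $ i) = - (sgn (h $ i - s) * sgn (h $ i))"
      by (simp add: l_def sgn_mult \<phi>sgn)
    then show "l $ i < 0 \<longleftrightarrow> (h $ i < 0 \<longleftrightarrow> h $ i < s)" "l $ i \<noteq> 0"
      using hs[of i] h0[of i] by (auto simp: sgn_real_def split: if_splits)
  qed
  have "card {i. h $ i < 0} = j"
    using j by (simp add: morse_index_def eigH size_filter_image_mset_set)
  moreover have "card {i. h $ i < s} = k"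
    using gap(1) by (simp add: eigH size_filter_image_mset_set)
  ultimately have jk: "j = k \<longleftrightarrow> (\<forall>i. l $ i < 0)"
    unfolding l_neg using card_below_eq_iff[of "($) h" 0 s] by simp
  have contF: "continuous_on D F"
    unfolding F
  proof (intro continuous_on_minus bounded_bilinear.continuous_on[OF bounded_bilinear_matrix_vector_mult] contR)
    show "continuous_on D (gradient E)"
      using dg by (intro has_derivative_continuous_on)
  qed
  have "locally_exponentially_stable F D p \<longleftrightarrow> j = k" if "p \<in> interior D"
    unfolding jk by (rule symmetric_linearization_stability[OF Q linF[unfolded L] that contF l_nz])
  moreover have "p \<in> interior D" if "\<forall>i\<in>{1..CARD('n)}. \<alpha> * (eigval (?H p) i - s) \<in> interior J"
  proof -
    have "p \<in> interior {x. set_mset (eigenvalues (\<alpha> *\<^sub>R (?H x - s *\<^sub>R mat 1))) \<subseteq> interior J}"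
      using that unfolding shifted_eigvals_in_iff[OF sym]
      by (intro shifted_spectrum_interior[OF contH sym]) auto
    then show ?thesis
      unfolding D by (rule subsetD[OF interior_mono, rotated]) (use interior_subset in blast)
  qed
  ultimately show ?thesis
    unfolding Let_def L_def[symmetric] M_def[symmetric] F_def[symmetric] D_def[symmetric]
    using linF linM \<open>inertia L = inertia M\<close> by blast
qed

end
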